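(* Let $m\in\mathbb{R}_{+}$ and let $\phi_1,\phi_2\in H^{m-1/2-}(\mathbb{T})$ be of the form $$\phi_1=\sum_{n\in\mathbb{N}^*}a_n^1\sin(nx),\qquad \phi_2=\sum_{n\in\mathbb{N}}a_n^2\cos(nx),$$ with real coefficients such that $a_0^2\neq 0$ and, for some constants $c,C>0$, $c\,n^{-m}<|a_n^k|<C\,n^{-m}$ for all $k\in\{1,2\}$ and $n\in\mathbb{N}^*$. Then for any $\lambda>0$ there exist linear feedback functionals $K_1,K_2$, bounded on $H^{m+1/2+}(\mathbb{T})$, such that for any $r\in(-1/2,1/2)$ and any $y_0\in H^{m+r}(\mathbb{T})$ the equation $$\partial_t y-\Delta y=K_1(y)\phi_1+K_2(y)\phi_2 \ \text{ on } (0,+\infty)\times\mathbb{T},\qquad y(0,\cdot)=y_0,$$ has a unique solution satisfying $$y\in C^0([0,+\infty);H^{m+r}(\mathbb{T}))\cap L^2_{loc}((0,+\infty);H^{m+r+1}(\mathbb{T}))\cap H^1_{loc}((0,+\infty);H^{m+r-1}(\mathbb{T})).$$ Moreover, $$\|y(t,\cdot)\|_{H^{m+r}}\le C_r e^{-\lambda t}\|y_0\|_{H^{m+r}},\qquad \forall t\in[0,+\infty),$$ where $C_r=C_r(\lambda,m)$ is a constant independent of $y_0$.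
   Context: $\mathbb{T}=\mathbb{R}/2\pi\mathbb{Z}$, $\mathbb{N}=\{0,1,2,\dots\}$, $\mathbb{N}^*=\{1,2,\dots\}$, $\Delta=\partial_x^2$; all functions are real valued. $f_n^1=\frac{1}{\sqrt\pi}\sin nx$, $f_n^2=\frac1{\sqrt\pi}\cos nx$ ($n\ge1$), $f_0^2=\frac1{\sqrt{2\pi}}$. For $s\in\mathbb{R}$, $H^s=H^s(\mathbb{T})$ is the Sobolev space of series $f=\sum_{n\ge1}b_n^1f_n^1+\sum_{n\ge0}b_n^2f_n^2$ with finite norm $\|f\|_{H^s}^2=(b_0^2)^2+\sum_{n\ge1}n^{2s}((b_n^1)^2+(b_n^2)^2)$ (here $b_0^2$ denotes the coefficient with upper index 2). "$y\in H^{s-}$" means $y\in H^{s-\varepsilon}$ for all $\varepsilon>0$; "a functional is bounded on $H^{s+}$" means that it is a bounded functional $H^{s+\varepsilon}\to\mathbb{R}$ for all $\varepsilon>0$. The equation is understood to hold in $L^2_{loc}((0,+\infty);H^{m+r-1})$. The functionals $K_1,K_2$ do not depend on $r$ or $y_0$. *)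

theory Defs
  imports "HOL-Analysis.Analysis" "HOL-Library.Function_Algebras"
begin

section \<open>The Hilbert space of square-summable families\<close>

text \<open>A separable real Hilbert space type. It is the model of every \<open>H\<^sup>s\<close> (see \<open>emb\<close> below), so that the
  library's continuity, measurability and Bochner integral apply to \<open>H\<^sup>s\<close>-valued functions.\<close>

typedef 'i ell2 = "{x :: 'i \<Rightarrow> real. (\<lambda>i. (x i)\<^sup>2) summable_on UNIV}"
  morphisms coord Abs_ell2
  by (rule exI[of _ "\<lambda>_. 0"]) simp

setup_lifting type_definition_ell2

lemma square_summable_mult:
  fixes x y :: "'i \<Rightarrow> real"
  assumes "(\<lambda>i. (x i)\<^sup>2) summable_on UNIV" "(\<lambda>i. (y i)\<^sup>2) summable_on UNIV"
  shows "(\<lambda>i. x i * y i) summable_on UNIV"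
proof -
  have "(\<lambda>i. (x i)\<^sup>2 + (y i)\<^sup>2) summable_on UNIV"
    using assms by (rule summable_on_add)
  then have "(\<lambda>i. norm (x i * y i)) summable_on UNIV"
  proof (rule summable_on_comparison_test)
    fix i
    have "0 \<le> (\<bar>x i\<bar> - \<bar>y i\<bar>)\<^sup>2" by simp
    then have "2 * (\<bar>x i\<bar> * \<bar>y i\<bar>) \<le> (x i)\<^sup>2 + (y i)\<^sup>2"
      by (simp add: power2_diff)
    moreover have "0 \<le> \<bar>x i\<bar> * \<bar>y i\<bar>" by simp
    ultimately show "norm (x i * y i) \<le> (x i)\<^sup>2 + (y i)\<^sup>2"
      unfolding real_norm_def abs_mult by linarith
  qed auto
  then show ?thesis
    using summable_on_iff_abs_summable_on_real by blast
qed

lemma square_summable_add: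
  fixes x y :: "'i \<Rightarrow> real"
  assumes "(\<lambda>i. (x i)\<^sup>2) summable_on UNIV" "(\<lambda>i. (y i)\<^sup>2) summable_on UNIV"
  shows "(\<lambda>i. (x i + y i)\<^sup>2) summable_on UNIV"
proof -
  have "(\<lambda>i. ((x i)\<^sup>2 + (y i)\<^sup>2) + 2 * (x i * y i)) summable_on UNIV"
    by (intro summable_on_add summable_on_cmult_right square_summable_mult assms)
  then show ?thesis by (simp add: power2_sum mult.assoc)
qed

lemma square_summable_scale:
  fixes x :: "'i \<Rightarrow> real"
  assumes "(\<lambda>i. (x i)\<^sup>2) summable_on UNIV"
  shows "(\<lambda>i. (r * x i)\<^sup>2) summable_on UNIV"
  using summable_on_cmult_right[OF assms, of "r\<^sup>2"] by (simp add: power_mult_distrib)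

instantiation ell2 :: (type) real_vector
begin

lift_definition zero_ell2 :: "'a ell2" is "\<lambda>_. 0" by simp
lift_definition plus_ell2 :: "'a ell2 \<Rightarrow> 'a ell2 \<Rightarrow> 'a ell2" is "\<lambda>x y i. x i + y i"
  by (rule square_summable_add)
lift_definition uminus_ell2 :: "'a ell2 \<Rightarrow> 'a ell2" is "\<lambda>x i. - x i" by simp
lift_definition minus_ell2 :: "'a ell2 \<Rightarrow> 'a ell2 \<Rightarrow> 'a ell2" is "\<lambda>x y i. x i - y i"
  using square_summable_add[of _ "\<lambda>i. - _ i"] by simp
lift_definition scaleR_ell2 :: "real \<Rightarrow> 'a ell2 \<Rightarrow> 'a ell2" is "\<lambda>r x i. r * x i"
  by (rule square_summable_scale)

instance
  by standard (transfer; simp add: algebra_simps)+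

end

instantiation ell2 :: (type) real_inner
begin

lift_definition inner_ell2 :: "'a ell2 \<Rightarrow> 'a ell2 \<Rightarrow> real" is "\<lambda>x y. \<Sum>\<^sub>\<infinity>i. x i * y i" .

definition "norm (x :: 'a ell2) = sqrt (x \<bullet> x)"
definition "dist (x :: 'a ell2) y = norm (x - y)"
definition "sgn (x :: 'a ell2) = inverse (norm x) *\<^sub>R x"
definition "(uniformity :: ('a ell2 \<times> 'a ell2) filter) = (INF e\<in>{0<..}. principal {(x, y). dist x y < e})"
definition "open (U :: 'a ell2 set) = (\<forall>x\<in>U. \<forall>\<^sub>F (x', y) in uniformity. x' = x \<longrightarrow> y \<in> U)"

instance
proof
  fix x y z :: "'a ell2" and r :: real
  show "dist x y = norm (x - y)" by (rule dist_ell2_def)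
  show "sgn x = x /\<^sub>R norm x" by (simp add: sgn_ell2_def)
  show "(uniformity :: ('a ell2 \<times> 'a ell2) filter) = (INF e\<in>{0<..}. principal {(x, y). dist x y < e})"
    by (rule uniformity_ell2_def)
  show "open U = (\<forall>x\<in>U. \<forall>\<^sub>F (x', y) in uniformity. x' = x \<longrightarrow> y \<in> U)" for U :: "'a ell2 set"
    by (rule open_ell2_def)
  show "x \<bullet> y = y \<bullet> x" by transfer (simp add: mult.commute)
  show "(x + y) \<bullet> z = x \<bullet> z + y \<bullet> z"
    by transfer (simp add: distrib_right infsum_add square_summable_mult)
  show "(r *\<^sub>R x) \<bullet> y = r * (x \<bullet> y)"
    by transfer (simp add: mult.assoc infsum_cmult_right')
  show "0 \<le> x \<bullet> x" by transfer (simp add: infsum_nonneg)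
  show "(x \<bullet> x = 0) = (x = 0)"
  proof (transfer, safe)
    fix x :: "'a \<Rightarrow> real"
    assume s: "(\<lambda>i. (x i)\<^sup>2) summable_on UNIV" and z: "(\<Sum>\<^sub>\<infinity>i. x i * x i) = 0"
    show "x = (\<lambda>_. 0)"
    proof
      fix i
      have "(\<Sum>j\<in>{i}. (x j)\<^sup>2) \<le> (\<Sum>\<^sub>\<infinity>i. (x i)\<^sup>2)"
        by (rule finite_sum_le_infsum) (use s in auto)
      then show "x i = 0" using z[folded power2_eq_square] by simp
    qed
  qed simp
  show "norm x = sqrt (x \<bullet> x)" by (rule norm_ell2_def)
qed

end

lemma norm_ell2_square: "(norm x)\<^sup>2 = (\<Sum>\<^sub>\<infinity>i. (coord x i)\<^sup>2)"
  unfolding power2_norm_eq_inner inner_ell2.rep_eq by (simp only: power2_eq_square)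

lemma coord_square_summable: "(\<lambda>i. (coord x i)\<^sup>2) summable_on UNIV"
  using coord[of x] by simp

lemma finite_sum_coord_le: "finite F \<Longrightarrow> (\<Sum>i\<in>F. (coord x i)\<^sup>2) \<le> (norm x)\<^sup>2"
  unfolding norm_ell2_square by (rule finite_sum_le_infsum[OF coord_square_summable]) auto

lemma abs_coord_le: "\<bar>coord x i\<bar> \<le> norm x"
  using finite_sum_coord_le[of "{i}" x] abs_le_square_iff[of "coord x i" "norm x"] by simp

instance ell2 :: (type) banach
proof
  fix X :: "nat \<Rightarrow> 'a ell2"
  assume X: "Cauchy X"
  have "Cauchy (\<lambda>n. coord (X n) i)" for i
  proof (rule metric_CauchyI)
    fix e :: real assume "e > 0"
    then obtain N where N: "\<And>m n. m \<ge> N \<Longrightarrow> n \<ge> N \<Longrightarrow> dist (X m) (X n) < e"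
      using metric_CauchyD[OF X] by blast
    have "dist (coord (X m) i) (coord (X n) i) < e" if "m \<ge> N" "n \<ge> N" for m n
      using N[OF that] abs_coord_le[of "X m - X n" i]
      by (simp add: dist_norm minus_ell2.rep_eq)
    then show "\<exists>N. \<forall>m\<ge>N. \<forall>n\<ge>N. dist (coord (X m) i) (coord (X n) i) < e" by blast
  qed
  then have "\<forall>i. \<exists>l. (\<lambda>n. coord (X n) i) \<longlonglongrightarrow> l"
    by (auto simp: Cauchy_convergent_iff convergent_def)
  then obtain x where x: "\<And>i. (\<lambda>n. coord (X n) i) \<longlonglongrightarrow> x i"
    by (auto dest!: choice)
  have tail: "(\<Sum>i\<in>F. (coord (X m) i - x i)\<^sup>2) \<le> e\<^sup>2"
    if N: "\<And>m n. m \<ge> N \<Longrightarrow> n \<ge> N \<Longrightarrow> dist (X m) (X n) < e" and "m \<ge> N" "finite F" for N m e F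
  proof (rule LIMSEQ_le_const2)
    show "(\<lambda>n. \<Sum>i\<in>F. (coord (X m) i - coord (X n) i)\<^sup>2) \<longlonglongrightarrow> (\<Sum>i\<in>F. (coord (X m) i - x i)\<^sup>2)"
      by (intro tendsto_intros x)
    have "(\<Sum>i\<in>F. (coord (X m) i - coord (X n) i)\<^sup>2) \<le> e\<^sup>2" if "n \<ge> N" for n
    proof -
      have "(\<Sum>i\<in>F. (coord (X m) i - coord (X n) i)\<^sup>2) \<le> (norm (X m - X n))\<^sup>2"
        using finite_sum_coord_le[OF \<open>finite F\<close>, of "X m - X n"] by (simp add: minus_ell2.rep_eq)
      also have "\<dots> \<le> e\<^sup>2"
        using N[OF \<open>m \<ge> N\<close> that] by (intro power_mono) (auto simp: dist_norm)
      finally show ?thesis .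
    qed
    then show "\<exists>N. \<forall>n\<ge>N. (\<Sum>i\<in>F. (coord (X m) i - coord (X n) i)\<^sup>2) \<le> e\<^sup>2" by blast
  qed
  have diff: "(\<lambda>i. (coord (X m) i - x i)\<^sup>2) summable_on UNIV \<and> (\<Sum>\<^sub>\<infinity>i. (coord (X m) i - x i)\<^sup>2) \<le> e\<^sup>2"
    if N: "\<And>m n. m \<ge> N \<Longrightarrow> n \<ge> N \<Longrightarrow> dist (X m) (X n) < e" and "m \<ge> N" for N m e
  proof
    show s: "(\<lambda>i. (coord (X m) i - x i)\<^sup>2) summable_on UNIV"
      by (rule nonneg_bdd_above_summable_on)
        (auto intro!: bdd_aboveI2[where M = "e\<^sup>2"] tail[OF N \<open>m \<ge> N\<close>])
    show "(\<Sum>\<^sub>\<infinity>i. (coord (X m) i - x i)\<^sup>2) \<le> e\<^sup>2"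
      by (rule infsum_le_finite_sums[OF s]) (rule tail[OF N \<open>m \<ge> N\<close>])
  qed
  obtain N where "\<And>m n. m \<ge> N \<Longrightarrow> n \<ge> N \<Longrightarrow> dist (X m) (X n) < 1"
    using metric_CauchyD[OF X, of 1] by auto
  then have "(\<lambda>i. (coord (X N) i - x i)\<^sup>2) summable_on UNIV" using diff by blast
  from square_summable_add[OF coord_square_summable square_summable_scale[OF this, of "-1"], of "X N"]
  have "(\<lambda>i. (x i)\<^sup>2) summable_on UNIV" by simp
  then have c: "coord (Abs_ell2 x) = x" by (simp add: Abs_ell2_inverse)
  have "X \<longlonglongrightarrow> Abs_ell2 x"
  proof (rule metric_LIMSEQ_I)
    fix e :: real assume "e > 0"
    then obtain N where N: "\<And>m n. m \<ge> N \<Longrightarrow> n \<ge> N \<Longrightarrow> dist (X m) (X n) < e / 2"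
      using metric_CauchyD[OF X, of "e / 2"] by auto
    have "dist (X m) (Abs_ell2 x) < e" if "m \<ge> N" for m
    proof -
      have "(norm (X m - Abs_ell2 x))\<^sup>2 \<le> (e / 2)\<^sup>2"
        using diff[OF N that] by (simp add: norm_ell2_square minus_ell2.rep_eq c)
      then have "norm (X m - Abs_ell2 x) \<le> e / 2"
        by (rule power2_le_imp_le) (use \<open>e > 0\<close> in simp)
      then show ?thesis using \<open>e > 0\<close> by (simp add: dist_norm)
    qed
    then show "\<exists>N. \<forall>n\<ge>N. dist (X n) (Abs_ell2 x) < e" by blast
  qed
  then show "convergent X" by (auto simp: convergent_def)
qed

lemma ell2_countable_dense:
  "\<exists>D :: 'i::countable ell2 set. countable D \<and> (\<forall>x. \<forall>e>0. \<exists>d\<in>D. dist d x < e)"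
proof -
  define D :: "'i ell2 set" where
    "D = (\<Union>F\<in>Collect finite. (\<lambda>g. Abs_ell2 (\<lambda>i. if i \<in> F then g i else 0)) ` (PiE F (\<lambda>_. \<rat>)))"
  have "countable D"
    unfolding D_def
    by (intro countable_UN countable_image countable_Collect_finite countable_PiE countable_rat) auto
  moreover have "\<exists>d\<in>D. dist d x < e" if "e > 0" for x e
  proof -
    have "(sum (\<lambda>i. (coord x i)\<^sup>2) \<longlongrightarrow> (norm x)\<^sup>2) (finite_subsets_at_top UNIV)"
      using has_sum_infsum[OF coord_square_summable[of x]]
      unfolding has_sum_def norm_ell2_square .
    then have "\<forall>\<^sub>F F in finite_subsets_at_top UNIV. dist (\<Sum>i\<in>F. (coord x i)\<^sup>2) ((norm x)\<^sup>2) < e\<^sup>2 / 2"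
      using \<open>e > 0\<close> by (intro tendstoD) auto
    then obtain F where F: "finite F" "dist (\<Sum>i\<in>F. (coord x i)\<^sup>2) ((norm x)\<^sup>2) < e\<^sup>2 / 2"
      by (auto simp: eventually_finite_subsets_at_top)
    define \<delta> where "\<delta> = e / (2 * sqrt (card F + 1))"
    have "\<delta> > 0" using \<open>e > 0\<close> by (simp add: \<delta>_def add_nonneg_pos)
    have "\<exists>q\<in>\<rat>. \<bar>q - coord x i\<bar> < \<delta>" for i
      using Rats_dense_in_real[of "coord x i" "coord x i + \<delta>"] \<open>\<delta> > 0\<close> by force
    then obtain q where q: "\<And>i. q i \<in> \<rat>" "\<And>i. \<bar>q i - coord x i\<bar> < \<delta>" by metis
    define d :: "'i ell2" where "d = Abs_ell2 (\<lambda>i. if i \<in> F then restrict q F i else 0)"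
    have "(\<lambda>i. (if i \<in> F then restrict q F i else 0 :: real)\<^sup>2) summable_on UNIV"
      by (rule summable_on_cong_neutral[THEN iffD1, OF _ _ _ summable_on_finite[OF F(1)]]) auto
    then have cd: "coord d i = (if i \<in> F then q i else 0)" for i
      by (simp add: d_def Abs_ell2_inverse)
    have "d \<in> D"
    proof -
      have "restrict q F \<in> PiE F (\<lambda>_. \<rat>)" using q(1) by simp
      then show ?thesis unfolding D_def d_def using F(1) by (intro UN_I[of F] image_eqI[of _ _ "restrict q F"]) auto
    qed
    moreover have "(norm (d - x))\<^sup>2 < e\<^sup>2"
    proof -
      have split: "(norm z)\<^sup>2 = (\<Sum>i\<in>F. (coord z i)\<^sup>2) + (\<Sum>\<^sub>\<infinity>i\<in>-F. (coord z i)\<^sup>2)" for z :: "'i ell2"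
      proof -
        have s: "(\<lambda>i. (coord z i)\<^sup>2) summable_on A" for A
          by (rule summable_on_subset_banach[OF coord_square_summable]) simp
        show ?thesis
          unfolding norm_ell2_square
          using infsum_Un_disjoint[OF s[of F] s[of "-F"]] F(1) by simp
      qed
      have "(\<Sum>\<^sub>\<infinity>i\<in>-F. (coord (d - x) i)\<^sup>2) = (\<Sum>\<^sub>\<infinity>i\<in>-F. (coord x i)\<^sup>2)"
        by (rule infsum_cong) (simp add: minus_ell2.rep_eq cd)
      moreover have "(norm x)\<^sup>2 - (\<Sum>i\<in>F. (coord x i)\<^sup>2) < e\<^sup>2 / 2"
        using F(2) unfolding dist_real_def by linarith
      moreover have "(\<Sum>i\<in>F. (coord (d - x) i)\<^sup>2) \<le> (\<Sum>i\<in>F. \<delta>\<^sup>2)"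
      proof (rule sum_mono)
        fix i assume "i \<in> F"
        have "\<bar>q i - coord x i\<bar> \<le> \<bar>\<delta>\<bar>" using q(2)[of i] by linarith
        then show "(coord (d - x) i)\<^sup>2 \<le> \<delta>\<^sup>2"
          using \<open>i \<in> F\<close> by (simp add: minus_ell2.rep_eq cd abs_le_square_iff)
      qed
      moreover have "(\<Sum>i\<in>F. \<delta>\<^sup>2) \<le> e\<^sup>2 / 2"
      proof -
        have "(\<Sum>i\<in>F. \<delta>\<^sup>2) = (card F / (card F + 1)) * (e\<^sup>2 / 4)"
          by (simp add: \<delta>_def power_divide power_mult_distrib)
        also have "\<dots> \<le> 1 * (e\<^sup>2 / 4)"
          by (intro mult_right_mono) auto
        also have "\<dots> \<le> e\<^sup>2 / 2" by simp
        finally show ?thesis .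
      qed
      ultimately show ?thesis using split[of "d - x"] split[of x] by linarith
    qed
    then have "dist d x < e"
      using power2_less_imp_less[of "norm (d - x)" e] \<open>e > 0\<close> by (simp add: dist_norm)
    ultimately show ?thesis by blast
  qed
  ultimately show ?thesis by blast
qed

instance ell2 :: (countable) second_countable_topology
proof
  obtain D :: "'a ell2 set" where D: "countable D" "\<And>x e. e > 0 \<Longrightarrow> \<exists>d\<in>D. dist d x < e"
    using ell2_countable_dense by blast
  define B where "B = (\<lambda>(d, q). ball d q) ` (D \<times> \<rat>)"
  have "countable B"
    unfolding B_def by (intro countable_image countable_SIGMA D(1) countable_rat)
  moreover have "topological_basis B"
  proof (rule topological_basisI)
    show "open b" if "b \<in> B" for b using that by (auto simp: B_def)
    fix U :: "'a ell2 set" and x assume "open U" "x \<in> U"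
    then obtain e where e: "e > 0" "ball x e \<subseteq> U" using open_contains_ball by blast
    obtain q where q: "q \<in> \<rat>" "e / 4 < q" "q < e / 2"
      using Rats_dense_in_real[of "e / 4" "e / 2"] e(1) by auto
    obtain d where d: "d \<in> D" "dist d x < e / 4" using D(2)[of "e / 4" x] e(1) by auto
    have "ball d q \<subseteq> ball x e"
    proof
      fix z assume "z \<in> ball d q"
      then have "dist d z < e / 2" using q(3) by simp
      then show "z \<in> ball x e"
        using dist_triangle[of x z d] d(2) e(1) unfolding mem_ball dist_commute[of x d] by linarith
    qed
    moreover have "x \<in> ball d q" using d(2) q(2) by simp
    moreover have "ball d q \<in> B" using d(1) q(1) by (auto simp: B_def)
    ultimately show "\<exists>b\<in>B. x \<in> b \<and> b \<subseteq> U" using e(2) by blast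
  qed
  ultimately show "\<exists>B :: 'a ell2 set set. countable B \<and> open = generate_topology B"
    using topological_basis_imp_subbasis by blast
qed

section \<open>Formal Fourier series and the spaces \<open>H\<^sup>s\<close>\<close>

text \<open>A series \<open>\<Sum>\<^sub>n\<^sub>\<ge>\<^sub>1 b\<^sub>n\<^sup>1 f\<^sub>n\<^sup>1 + \<Sum>\<^sub>n\<^sub>\<ge>\<^sub>0 b\<^sub>n\<^sup>2 f\<^sub>n\<^sup>2\<close> is its family of coefficients, indexed by the integers: for
  \<open>n \<ge> 1\<close> the sine coefficient \<open>b\<^sub>n\<^sup>1\<close> sits at \<open>-n\<close>, and for \<open>n \<ge> 0\<close> the cosine coefficient \<open>b\<^sub>n\<^sup>2\<close>
  sits at \<open>n\<close>.\<close>

type_synonym fseries = "int \<Rightarrow> real"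

instantiation "fun" :: (type, real_vector) real_vector
begin

definition "r *\<^sub>R f = (\<lambda>x. r *\<^sub>R f x)" for f :: "'a \<Rightarrow> 'b"

instance
  by standard (simp_all add: scaleR_fun_def fun_eq_iff algebra_simps)

end

definition trig_basis :: "int \<Rightarrow> real \<Rightarrow> real" where
  "trig_basis j x =
    (if j < 0 then sin (of_int (- j) * x) / sqrt pi
     else if j = 0 then 1 / sqrt (2 * pi)
     else cos (of_int j * x) / sqrt pi)"

definition H :: "real \<Rightarrow> fseries set" where
  "H s = {f. summable (\<lambda>n. real (Suc n) powr (2 * s) * ((f (- int (Suc n)))\<^sup>2 + (f (int (Suc n)))\<^sup>2))}"

definition hnorm :: "real \<Rightarrow> fseries \<Rightarrow> real" where
  "hnorm s f = sqrt ((f 0)\<^sup>2 +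
     (\<Sum>n. real (Suc n) powr (2 * s) * ((f (- int (Suc n)))\<^sup>2 + (f (int (Suc n)))\<^sup>2)))"

text \<open>The isometry of \<open>H\<^sup>s\<close> onto \<open>int ell2\<close> (see \<open>norm_emb\<close>, \<open>surj_emb\<close>), with the junk value \<open>0\<close>
  outside \<open>H\<^sup>s\<close>.\<close>

definition wt :: "real \<Rightarrow> int \<Rightarrow> real" where
  "wt s j = (if j = 0 then 1 else \<bar>of_int j\<bar> powr s)"

definition emb :: "real \<Rightarrow> fseries \<Rightarrow> int ell2" where
  "emb s f = (if f \<in> H s then Abs_ell2 (\<lambda>j. wt s j * f j) else 0)"

lemma weighted_square_summable:
  "((\<lambda>j. (wt s j * f j)\<^sup>2) summable_on UNIV \<longleftrightarrow> f \<in> H s) \<and>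
   (f \<in> H s \<longrightarrow> (\<Sum>\<^sub>\<infinity>j. (wt s j * f j)\<^sup>2) = (hnorm s f)\<^sup>2)"
proof -
  define g where "g = (\<lambda>j. (wt s j * f j)\<^sup>2)"
  define p q :: "nat \<Rightarrow> int" where "p = (\<lambda>n. int (Suc n))" and "q = (\<lambda>n. - int (Suc n))"
  have inj: "inj p" "inj q" by (auto simp: p_def q_def inj_def)
  have U: "(UNIV :: int set) = ({0} \<union> range p) \<union> range q"
  proof -
    have "j \<in> ({0} \<union> range p) \<union> range q" for j :: int
    proof (cases j rule: int_cases3)
      case (pos n)
      then have "j = p (n - 1)" by (simp add: p_def)
      then show ?thesis by blast
    next
      case (neg n)
      then have "j = q (n - 1)" by (simp add: q_def)
      then show ?thesis by blast
    qed simp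
    then show ?thesis by blast
  qed
  have disj: "{0} \<inter> range p = {}" "({0} \<union> range p) \<inter> range q = {}"
    by (auto simp: p_def q_def)
  have nn: "g j \<ge> 0" for j by (simp add: g_def)
  have sq: "(real (Suc n) powr s)\<^sup>2 = real (Suc n) powr (2 * s)" for n
    by (simp add: powr_power mult.commute)
  have w: "wt s (int (Suc n)) = real (Suc n) powr s" "wt s (- int (Suc n)) = real (Suc n) powr s" for n
    by (simp_all add: wt_def abs_if add.commute)
  have trm: "real (Suc n) powr (2 * s) * ((f (- int (Suc n)))\<^sup>2 + (f (int (Suc n)))\<^sup>2) = g (q n) + g (p n)" for n
    unfolding g_def p_def q_def power_mult_distrib w sq[symmetric] by (simp only: distrib_left)
  have S: "summable h \<longleftrightarrow> h summable_on UNIV" if "\<And>n. h n \<ge> 0" for h :: "nat \<Rightarrow> real"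
    using summable_on_UNIV_nonneg_real_iff[of h] that by simp
  have H: "f \<in> H s \<longleftrightarrow> summable (\<lambda>n. g (q n) + g (p n))"
    unfolding H_def mem_Collect_eq trm ..
  have reindex: "g summable_on range h \<longleftrightarrow> summable (\<lambda>n. g (h n))" if "inj h" for h :: "nat \<Rightarrow> int"
    using summable_on_reindex[OF that, of g] S[of "\<lambda>n. g (h n)"] nn by (simp add: o_def)
  have "f \<in> H s \<longleftrightarrow> summable (\<lambda>n. g (q n)) \<and> summable (\<lambda>n. g (p n))"
  proof
    assume "f \<in> H s"
    then have "summable (\<lambda>n. g (q n) + g (p n))" by (simp add: H)
    then show "summable (\<lambda>n. g (q n)) \<and> summable (\<lambda>n. g (p n))"
      using nn by (auto intro: summable_comparison_test')
  qed (simp add: H summable_add)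
  also have "\<dots> \<longleftrightarrow> g summable_on UNIV"
  proof
    assume "summable (\<lambda>n. g (q n)) \<and> summable (\<lambda>n. g (p n))"
    then have "g summable_on range q" "g summable_on range p" by (simp_all add: reindex inj)
    then show "g summable_on UNIV"
      unfolding U by (intro summable_on_Un_disjoint disj) auto
  next
    assume "g summable_on UNIV"
    then have "g summable_on A" for A by (rule summable_on_subset_banach) simp
    then show "summable (\<lambda>n. g (q n)) \<and> summable (\<lambda>n. g (p n))"
      using reindex inj by blast
  qed
  finally have iff: "f \<in> H s \<longleftrightarrow> g summable_on UNIV" .
  moreover have "infsum g UNIV = (hnorm s f)\<^sup>2" if "f \<in> H s"
  proof -
    have s: "g summable_on A" for A
      by (rule summable_on_subset_banach[OF iff[THEN iffD1, OF that]]) simp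
    have i: "infsum g (range h) = (\<Sum>n. g (h n))" if "inj h" for h :: "nat \<Rightarrow> int"
    proof -
      have "(\<lambda>n. g (h n)) summable_on UNIV" using s[of "range h"] reindex[OF that] S[of "\<lambda>n. g (h n)"] nn by simp
      then have "(\<lambda>n. g (h n)) sums (\<Sum>\<^sub>\<infinity>n. g (h n))"
        by (intro has_sum_imp_sums has_sum_infsum)
      then show ?thesis using infsum_reindex[OF that, of g] by (simp add: o_def sums_iff)
    qed
    have "summable (\<lambda>n. g (q n))" "summable (\<lambda>n. g (p n))"
      using s[of "range p"] s[of "range q"] reindex inj by simp_all
    then have "(\<Sum>n. g (q n) + g (p n)) = (\<Sum>n. g (q n)) + (\<Sum>n. g (p n))"
      by (simp add: suminf_add)
    moreover have "infsum g UNIV = (g 0 + (\<Sum>n. g (p n))) + (\<Sum>n. g (q n))"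
      unfolding U infsum_Un_disjoint[OF s s disj(2)] infsum_Un_disjoint[OF s s disj(1)]
      by (simp add: i inj)
    moreover have "(hnorm s f)\<^sup>2 = (f 0)\<^sup>2 + (\<Sum>n. g (q n) + g (p n))"
      unfolding hnorm_def trm
      by (rule real_sqrt_pow2) (intro add_nonneg_nonneg suminf_nonneg H[THEN iffD1, OF that] nn zero_le_power2)
    moreover have "g 0 = (f 0)\<^sup>2" by (simp add: g_def wt_def)
    ultimately show ?thesis by simp
  qed
  ultimately show ?thesis unfolding g_def by blast
qed

lemma coord_emb: "f \<in> H s \<Longrightarrow> coord (emb s f) j = wt s j * f j"
  using weighted_square_summable[of s f] by (simp add: emb_def Abs_ell2_inverse)

lemma norm_emb: "f \<in> H s \<Longrightarrow> norm (emb s f) = hnorm s f"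
proof -
  assume f: "f \<in> H s"
  have "(norm (emb s f))\<^sup>2 = (hnorm s f)\<^sup>2"
    using weighted_square_summable[of s f] f by (simp add: norm_ell2_square coord_emb)
  moreover have "hnorm s f \<ge> 0"
    using f unfolding H_def hnorm_def by (auto intro!: add_nonneg_nonneg suminf_nonneg)
  ultimately show ?thesis by simp
qed

lemma surj_emb: "emb s ` H s = UNIV"
proof -
  have "x \<in> emb s ` H s" for x
  proof -
    define f where "f = (\<lambda>j. coord x j / wt s j)"
    have w: "wt s j * f j = coord x j" for j by (simp add: f_def wt_def)
    then have "f \<in> H s"
      using weighted_square_summable[of s f] coord_square_summable[of x] by simp
    then have "emb s f = x" by (simp add: coord_inject[symmetric] coord_emb w fun_eq_iff)
    then show ?thesis using \<open>f \<in> H s\<close> by blast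
  qed
  then show ?thesis by blast
qed

text \<open>\<open>\<Sum>\<^sub>n\<^sub>\<ge>\<^sub>1 a\<^sub>n sin(nx)\<close> and \<open>\<Sum>\<^sub>n\<^sub>\<ge>\<^sub>0 a\<^sub>n cos(nx)\<close>, rewritten in the normalised basis; the factors are checked in
  \<open>sin_series_term\<close> and \<open>cos_series_term\<close>.\<close>

definition sin_series :: "(nat \<Rightarrow> real) \<Rightarrow> fseries" where
  "sin_series a j = (if j < 0 then sqrt pi * a (nat (- j)) else 0)"

definition cos_series :: "(nat \<Rightarrow> real) \<Rightarrow> fseries" where
  "cos_series a j =
    (if j < 0 then 0 else if j = 0 then sqrt (2 * pi) * a 0 else sqrt pi * a (nat j))"

lemma sin_series_term:
  "n \<ge> 1 \<Longrightarrow> sin_series a (- int n) * trig_basis (- int n) x = a n * sin (real n * x)"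
  by (simp add: sin_series_def trig_basis_def)

lemma cos_series_term:
  "cos_series a (int n) * trig_basis (int n) x = a n * cos (real n * x)"
  by (simp add: cos_series_def trig_basis_def)

definition laplace :: "fseries \<Rightarrow> fseries" where
  "laplace f j = - (of_int j)\<^sup>2 * f j"

lemma laplace_term: "f j * deriv (deriv (trig_basis j)) x = laplace f j * trig_basis j x"
proof -
  have ds: "deriv (\<lambda>x. b * sin (a * x) / d) = (\<lambda>x. (b * a) * cos (a * x) / d)" for a b d :: real
    by (rule ext, rule DERIV_imp_deriv, rule DERIV_cdivide) (auto intro!: derivative_eq_intros)
  have dc: "deriv (\<lambda>x. b * cos (a * x) / d) = (\<lambda>x. - (b * a) * sin (a * x) / d)" for a b d :: real
    by (rule ext, rule DERIV_imp_deriv, rule DERIV_cdivide) (auto intro!: derivative_eq_intros)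
  consider "j < 0" | "j = 0" | "j > 0" by linarith
  then show ?thesis
  proof cases
    case 1
    then have "trig_basis j = (\<lambda>x. 1 * sin (of_int (- j) * x) / sqrt pi)"
      by (simp add: trig_basis_def[abs_def])
    then show ?thesis by (simp only: ds dc) (simp add: laplace_def power2_eq_square)
  next
    case 2
    then show ?thesis by (simp add: laplace_def trig_basis_def[abs_def])
  next
    case 3
    then have "trig_basis j = (\<lambda>x. 1 * cos (of_int j * x) / sqrt pi)"
      by (simp add: trig_basis_def[abs_def])
    then show ?thesis by (simp only: ds dc) (simp add: laplace_def power2_eq_square)
  qed
qed

text \<open>Functionals are total on \<open>fseries\<close>; only their values on \<open>H s\<close> are constrained.\<close>

definition bounded_functional_on :: "real \<Rightarrow> (fseries \<Rightarrow> real) \<Rightarrow> bool" where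
  "bounded_functional_on s K \<longleftrightarrow>
    (\<forall>f\<in>H s. \<forall>g\<in>H s. K (f + g) = K f + K g) \<and>
    (\<forall>f\<in>H s. \<forall>r. K (r *\<^sub>R f) = r * K f) \<and>
    (\<exists>B. \<forall>f\<in>H s. \<bar>K f\<bar> \<le> B * hnorm s f)"

section \<open>Functions of time with values in \<open>H\<^sup>s\<close>\<close>

definition C0_H :: "real \<Rightarrow> (real \<Rightarrow> fseries) set" where
  "C0_H s = {u. (\<forall>t\<ge>0. u t \<in> H s) \<and> continuous_on {0..} (\<lambda>t. emb s (u t))}"

text \<open>\<open>L\<^sup>2\<^sub>l\<^sub>o\<^sub>c((0,\<infinity>); H\<^sup>s)\<close>, where \<open>u t\<close> has to lie in \<open>H\<^sup>s\<close> only for almost every \<open>t\<close>. As \<open>int ell2\<close> is separable, Borel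
  measurability is strong (Bochner) measurability.\<close>

definition L2loc_H :: "real \<Rightarrow> (real \<Rightarrow> fseries) set" where
  "L2loc_H s = {u.
    (AE t in lebesgue_on {0<..}. u t \<in> H s) \<and>
    (\<lambda>t. emb s (u t)) \<in> borel_measurable (lebesgue_on {0<..}) \<and>
    (\<forall>J. compact J \<longrightarrow> J \<subseteq> {0<..} \<longrightarrow> integrable (lebesgue_on J) (\<lambda>t. (norm (emb s (u t)))\<^sup>2))}"

definition test_function :: "(real \<Rightarrow> real) \<Rightarrow> bool" where
  "test_function \<phi> \<longleftrightarrow>
    (\<forall>k. (deriv ^^ k) \<phi> differentiable_on UNIV) \<and>
    (\<exists>J. compact J \<and> J \<subseteq> {0<..} \<and> (\<forall>t. t \<notin> J \<longrightarrow> \<phi> t = 0))"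

text \<open>\<open>v = \<partial>\<^sub>t u\<close> in the sense of \<open>H\<^sup>s\<close>-valued distributions on \<open>(0,\<infinity>)\<close>, for \<open>u\<close> and \<open>v\<close> in \<open>L2loc_H s\<close>.\<close>

definition weak_deriv :: "real \<Rightarrow> (real \<Rightarrow> fseries) \<Rightarrow> (real \<Rightarrow> fseries) \<Rightarrow> bool" where
  "weak_deriv s u v \<longleftrightarrow> (\<forall>\<phi>. test_function \<phi> \<longrightarrow>
    (LINT t|lebesgue_on {0<..}. deriv \<phi> t *\<^sub>R emb s (u t)) =
    - (LINT t|lebesgue_on {0<..}. \<phi> t *\<^sub>R emb s (v t)))"

definition H1loc_H :: "real \<Rightarrow> (real \<Rightarrow> fseries) set" where
  "H1loc_H s = {u \<in> L2loc_H s. \<exists>v\<in>L2loc_H s. weak_deriv s u v}"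

section \<open>The closed-loop equation\<close>

text \<open>\<open>\<partial>\<^sub>t y - \<Delta>y = K\<^sub>1(y)\<phi>\<^sub>1 + K\<^sub>2(y)\<phi>\<^sub>2\<close> as an identity in \<open>L\<^sup>2\<^sub>l\<^sub>o\<^sub>c((0,\<infinity>); H\<^sup>s)\<close>.\<close>

definition closed_loop_eq ::
  "real \<Rightarrow> (fseries \<Rightarrow> real) \<Rightarrow> (fseries \<Rightarrow> real) \<Rightarrow> fseries \<Rightarrow> fseries \<Rightarrow> (real \<Rightarrow> fseries) \<Rightarrow> bool" where
  "closed_loop_eq s K1 K2 \<phi>1 \<phi>2 y \<longleftrightarrow>
    (\<exists>v\<in>L2loc_H s. weak_deriv s y v \<and>
      (\<lambda>t. v t - laplace (y t)) \<in> L2loc_H s \<and>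
      (\<lambda>t. K1 (y t) *\<^sub>R \<phi>1 + K2 (y t) *\<^sub>R \<phi>2) \<in> L2loc_H s \<and>
      (AE t in lebesgue_on {0<..}. v t - laplace (y t) = K1 (y t) *\<^sub>R \<phi>1 + K2 (y t) *\<^sub>R \<phi>2))"

text \<open>Values at negative times are irrelevant.\<close>

definition is_solution ::
  "real \<Rightarrow> real \<Rightarrow> (fseries \<Rightarrow> real) \<Rightarrow> (fseries \<Rightarrow> real) \<Rightarrow> fseries \<Rightarrow> fseries \<Rightarrow> fseries
    \<Rightarrow> (real \<Rightarrow> fseries) \<Rightarrow> bool" where
  "is_solution m r K1 K2 \<phi>1 \<phi>2 y0 y \<longleftrightarrow>
    y \<in> C0_H (m + r) \<inter> L2loc_H (m + r + 1) \<inter> H1loc_H (m + r - 1) \<and>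
    closed_loop_eq (m + r - 1) K1 K2 \<phi>1 \<phi>2 y \<and>
    y 0 = y0"

end

theory Submission
  imports Defs
begin

text \<open>Only finitely many modes decay more slowly than \<open>exp (- \<Lambda> t)\<close>, so \<open>K1\<close> and \<open>K2\<close> may depend on the modes
  \<open>\<bar>p\<bar> \<le> N\<close> alone, where \<open>N \<ge> \<Lambda>\<close>. As all coefficients of \<open>\<phi>1\<close> (sines) and \<open>\<phi>2\<close> (cosines) are nonzero and the
  eigenvalues are simple within each parity, the rates of these modes can be moved to the distinct non-squares
  \<open>N + \<bar>p\<bar> + 1/2\<close>. The closed-loop operator is conjugated to a diagonal one by an isomorphism \<open>I + finite rank\<close>;
  the columns of the finite-rank part decay like \<open>n powr (- m - 2)\<close>, because dividing by a difference of
  eigenvalues gains two powers of \<open>n\<close>, so it acts on \<open>H s\<close> for all \<open>s < m + 3/2\<close>, which covers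
  \<open>m + r - 1, \<dots>, m + r + 1\<close>. The solution is the conjugate of the diagonal semigroup. For uniqueness, the
  coefficients of a solution are continuous with continuous weak derivative, hence classical solutions of scalar
  equations that decouple after the conjugation.\<close>

section \<open>Pole shifting\<close>

text \<open>The obstacle is spillover. Each profile has no vanishing coefficient in its own parity,
  so a feedback that moves one low mode drives every other mode of that parity. The driving terms
  also leave the state space: the profiles lie only in \<open>H s\<close> with s < m - 1/2, whereas
  the state lies in \<open>H (m + r)\<close> with r > -1/2. Solving for the correction divides these
  terms by eigenvalue differences and so brings it back into the state space; the most demanding
  case s = m + r + 1 < m + 3/2 is the condition r < 1/2. Every eigenvalue n^2 with n >= 1 is double
  (one sine, one cosine), hence the two controls. Simplicity within a parity keeps all input
  coefficients nonzero while the poles move, so each further pole remains movable. The target rates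
  are non-squares, so they never meet a pole that is still to be moved. The transformations are
  algebraic identities on arbitrary coefficient families. Spaces enter only afterwards, which is why
  the same functionals serve every r.\<close>

lemma wt_pos [simp]: "wt s j > 0"
  by (simp add: wt_def)

lemma wt_nonzero [simp]: "wt s j \<noteq> 0"
  using wt_pos[of s j] by linarith

lemma abs_wt [simp]: "\<bar>wt s j\<bar> = wt s j"
  using wt_pos[of s j] by linarith

lemma wt_mult: "wt a j * wt b j = wt (a + b) j"
  by (simp add: wt_def powr_add)

lemma wt_mono: "a \<le> b \<Longrightarrow> wt a j \<le> wt b j"
proof -
  assume "a \<le> b"
  have "j \<noteq> 0 \<Longrightarrow> 1 \<le> \<bar>real_of_int j\<bar>" by linarith
  with \<open>a \<le> b\<close> show ?thesis by (auto simp: wt_def intro: powr_mono)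
qed

text \<open>Order of growth \<open>a\<close>, with the zero mode given weight 1. Orders add under
  products and turn into Sobolev regularity through \<open>dominated_imp_H\<close>, so the estimates
  become arithmetic of exponents.\<close>

definition dominated :: "real \<Rightarrow> fseries \<Rightarrow> bool" where
  "dominated a g \<longleftrightarrow> (\<exists>B. \<forall>j. \<bar>g j\<bar> \<le> B * wt a j)"

lemma dominated_nonneg:
  assumes "dominated a g"
  shows "\<exists>B\<ge>0. \<forall>j. \<bar>g j\<bar> \<le> B * wt a j"
proof -
  obtain B where B: "\<And>j. \<bar>g j\<bar> \<le> B * wt a j" using assms unfolding dominated_def by blast
  have "0 \<le> B * wt a 0" using B[of 0] by linarith
  then have "B \<ge> 0" by (simp add: wt_def)
  then show ?thesis using B by blast
qed

lemma dominated_add: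
  assumes "dominated a f" "dominated a g"
  shows "dominated a (\<lambda>j. f j + g j)"
proof -
  obtain B C where B: "\<And>j. \<bar>f j\<bar> \<le> B * wt a j" and C: "\<And>j. \<bar>g j\<bar> \<le> C * wt a j"
    using assms unfolding dominated_def by blast
  have "\<bar>f j + g j\<bar> \<le> (B + C) * wt a j" for j
    using abs_triangle_ineq[of "f j" "g j"] B[of j] C[of j] unfolding distrib_right by linarith
  then show ?thesis unfolding dominated_def by blast
qed

lemma dominated_mult:
  assumes "dominated a f" "dominated b g"
  shows "dominated (a + b) (\<lambda>j. f j * g j)"
proof -
  obtain B where B: "\<And>j. \<bar>f j\<bar> \<le> B * wt a j"
    using assms unfolding dominated_def by blast
  obtain C where C: "C \<ge> 0" "\<And>j. \<bar>g j\<bar> \<le> C * wt b j"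
    using dominated_nonneg[OF assms(2)] by blast
  have "\<bar>f j * g j\<bar> \<le> (B * C) * wt (a + b) j" for j
  proof -
    have "\<bar>f j * g j\<bar> \<le> (B * wt a j) * (C * wt b j)"
      unfolding abs_mult by (rule mult_mono[OF B C(2)]) (use B[of j] in linarith)+
    then show ?thesis by (simp add: wt_mult[symmetric] mult_ac)
  qed
  then show ?thesis unfolding dominated_def by blast
qed

lemma dominated_const_mult:
  assumes "dominated a f"
  shows "dominated a (\<lambda>j. r * f j)"
proof -
  obtain B where B: "\<And>j. \<bar>f j\<bar> \<le> B * wt a j"
    using assms unfolding dominated_def by blast
  have "\<bar>r * f j\<bar> \<le> (\<bar>r\<bar> * B) * wt a j" for j
    using mult_left_mono[OF B[of j], of "\<bar>r\<bar>"] by (simp add: abs_mult mult.assoc)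
  then show ?thesis unfolding dominated_def by blast
qed

lemma dominated_zero: "dominated a (\<lambda>j. 0)"
  unfolding dominated_def by (rule exI[of _ 0]) simp

lemma dominated_sum:
  assumes "\<And>p. p \<in> F \<Longrightarrow> dominated a (f p)"
  shows "dominated a (\<lambda>j. \<Sum>p\<in>F. f p j)"
proof (cases "finite F")
  case True
  then show ?thesis using assms
    by (induction F) (simp_all add: dominated_zero dominated_add)
qed (simp add: dominated_zero)

lemma dominated_mono: "dominated a f \<Longrightarrow> a \<le> b \<Longrightarrow> dominated b f"
  using dominated_nonneg[of a f] unfolding dominated_def[of b]
  by (meson mult_left_mono order_trans wt_mono)

text \<open>Weights never vanish, so finitely many exceptional indices only enlarge the constant,
  here by the sum of all their quotients. This lets estimates ignore the zero frequency and the
  shifted modes.\<close>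

lemma dominated_cofinite:
  assumes "finite E" "\<And>j. j \<notin> E \<Longrightarrow> \<bar>g j\<bar> \<le> B * wt a j"
  shows "dominated a g"
proof -
  define C where "C = \<bar>B\<bar> + (\<Sum>i\<in>E. \<bar>g i\<bar> / wt a i)"
  have nn: "0 \<le> \<bar>g i\<bar> / wt a i" for i by (simp add: less_imp_le)
  have "\<bar>g j\<bar> \<le> C * wt a j" for j
  proof (cases "j \<in> E")
    case True
    have "\<bar>g j\<bar> / wt a j \<le> (\<Sum>i\<in>E. \<bar>g i\<bar> / wt a i)"
      by (rule member_le_sum[OF True nn assms(1)])
    then have "\<bar>g j\<bar> / wt a j \<le> C" by (simp add: C_def)
    then show ?thesis by (simp add: pos_divide_le_eq)
  next
    case False
    have "0 \<le> (\<Sum>i\<in>E. \<bar>g i\<bar> / wt a i)" by (rule sum_nonneg) (rule nn)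
    then have "B \<le> C" unfolding C_def by linarith
    then have "B * wt a j \<le> C * wt a j" by (intro mult_right_mono) (simp_all add: less_imp_le)
    then show ?thesis using assms(2)[OF False] by linarith
  qed
  then show ?thesis unfolding dominated_def by blast
qed

text \<open>The source of the gain of two orders: for large |j| the number \<open>\<nu>\<close> is
  negligible against j^2. A zero denominator can occur at finitely many indices only, where the
  value of the quotient is immaterial.\<close>

lemma dominated_resolvent:
  assumes "finite F" "\<And>j. j \<notin> F \<Longrightarrow> M j = (of_int j)\<^sup>2"
  shows "dominated (- 2) (\<lambda>j. 1 / (M j - \<nu>))"
proof (rule dominated_cofinite)
  \<comment> \<open>Beyond \<open>R\<close> one has j^2 >= 2 * |\<nu>| + 1, so subtracting
    \<open>\<nu>\<close> costs at most half of j^2; the summand 1 keeps j^2 positive.\<close>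
  define R where "R = \<lceil>2 * \<bar>\<nu>\<bar> + 1\<rceil>"
  show "finite (F \<union> {-R..R})" using assms(1) by simp
  fix j assume j: "j \<notin> F \<union> {-R..R}"
  have "\<bar>real_of_int j\<bar> \<ge> 2 * \<bar>\<nu>\<bar> + 1"
  proof -
    have "\<bar>j\<bar> \<ge> R" using j by auto
    moreover have "2 * \<bar>\<nu>\<bar> + 1 \<le> of_int R" unfolding R_def by (rule le_of_int_ceiling)
    ultimately show ?thesis by linarith
  qed
  moreover have "j\<^sup>2 \<ge> 0" by simp
  ultimately have "2 * \<bar>\<nu>\<bar> + 1 \<le> \<bar>real_of_int j\<bar> * \<bar>real_of_int j\<bar>"
    using mult_mono[of 1 "\<bar>real_of_int j\<bar>" "\<bar>real_of_int j\<bar>" "\<bar>real_of_int j\<bar>"] by linarith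
  then have "2 * \<bar>\<nu>\<bar> + 1 \<le> (real_of_int j)\<^sup>2"
    by (simp add: power2_eq_square flip: abs_mult)
  then have h: "(real_of_int j)\<^sup>2 / 2 \<le> (real_of_int j)\<^sup>2 - \<nu>" "0 < (real_of_int j)\<^sup>2"
    by (linarith, linarith)
  have "0 < (real_of_int j)\<^sup>2 - \<nu>" using h by linarith
  have "j \<noteq> 0" using h(2) by auto
  then have w: "wt (- 2) j = 1 / (real_of_int j)\<^sup>2"
    using powr_realpow[of "\<bar>real_of_int j\<bar>" 2] by (simp add: wt_def powr_minus_divide)
  have "1 / ((real_of_int j)\<^sup>2 - \<nu>) \<le> 1 / ((real_of_int j)\<^sup>2 / 2)"
    using h \<open>0 < (real_of_int j)\<^sup>2 - \<nu>\<close> by (intro divide_left_mono mult_pos_pos) auto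
  then show "\<bar>1 / (M j - \<nu>)\<bar> \<le> 2 * wt (- 2) j"
    using h(1) \<open>0 < (real_of_int j)\<^sup>2 - \<nu>\<close> j by (simp add: w assms(2))
qed

text \<open>The column \<open>\<lambda>j. c j p\<close> is the correction produced by mode
  \<open>p\<close>, and the decay of the columns decides on which spaces the operator acts. Only a
  finite sum occurs, so composition and inversion can be treated on all of \<open>fseries\<close>,
  without convergence.\<close>

definition fin_rank :: "int set \<Rightarrow> (int \<Rightarrow> int \<Rightarrow> real) \<Rightarrow> fseries \<Rightarrow> fseries" where
  "fin_rank F c x j = x j + (\<Sum>p\<in>F. c j p * x p)"

text \<open>From (I + C)(I + D) = I + D + C + CD: the finite-rank part of the product again reads
  only the modes in \<open>F\<close>.\<close>

definition fin_rank_comp :: "int set \<Rightarrow> (int \<Rightarrow> int \<Rightarrow> real) \<Rightarrow> (int \<Rightarrow> int \<Rightarrow> real) \<Rightarrow> int \<Rightarrow> int \<Rightarrow> real" where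
  "fin_rank_comp F c d j p = d j p + c j p + (\<Sum>q\<in>F. c j q * d q p)"

lemma fin_rank_fin_rank: "fin_rank F c (fin_rank F d x) = fin_rank F (fin_rank_comp F c d) x"
proof
  fix j
  have "(\<Sum>q\<in>F. c j q * (\<Sum>p\<in>F. d q p * x p)) = (\<Sum>p\<in>F. (\<Sum>q\<in>F. c j q * d q p) * x p)"
    unfolding sum_distrib_left sum_distrib_right mult.assoc by (rule sum.swap)
  then show "fin_rank F c (fin_rank F d x) j = fin_rank F (fin_rank_comp F c d) x j"
    by (simp add: fin_rank_def fin_rank_comp_def distrib_left distrib_right sum.distrib)
qed

text \<open>The columns of CD are finite combinations of columns of C, with coefficients
  \<open>d q p\<close> independent of \<open>j\<close>, so the order of decay survives every
  induction step of the pole shift.\<close>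

lemma dominated_fin_rank_comp:
  assumes "\<forall>p\<in>F. dominated a (\<lambda>j. c j p)" "\<forall>p\<in>F. dominated a (\<lambda>j. d j p)"
  shows "\<forall>p\<in>F. dominated a (\<lambda>j. fin_rank_comp F c d j p)"
proof
  fix p assume "p \<in> F"
  have "dominated a (\<lambda>j. \<Sum>q\<in>F. d q p * c j q)"
    by (intro dominated_sum dominated_const_mult) (use assms in auto)
  then show "dominated a (\<lambda>j. fin_rank_comp F c d j p)"
    unfolding fin_rank_comp_def mult.commute[of "c _ _"]
    using assms \<open>p \<in> F\<close> by (intro dominated_add) auto
qed

text \<open>The poles are moved one at a time. In a diagonal system \<open>x\<^sub>j' = - M\<^sub>j x\<^sub>j + \<beta>\<^sub>j u\<close>, the feedback
  \<open>u = - (\<kappa> / \<beta>\<^sub>p) x\<^sub>p\<close> replaces \<open>M\<^sub>p\<close> by \<open>M\<^sub>p + \<kappa>\<close> and couples every other mode to \<open>x\<^sub>p\<close> only; the change of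
  variables \<open>z\<^sub>j = x\<^sub>j + \<gamma>\<^sub>j x\<^sub>p\<close> with \<open>\<gamma>\<^sub>j (M\<^sub>j - M\<^sub>p - \<kappa>) = \<kappa> \<beta>\<^sub>j / \<beta>\<^sub>p\<close> removes this coupling. The sign of the
  index selects the control (\<open>True\<close>, negative indices: sine modes), and the free input \<open>u\<close> is what makes the
  induction compose.\<close>

lemma pole_shift:
  fixes \<beta> \<nu> :: "int \<Rightarrow> real"
  assumes F: "finite F" and \<beta>0: "\<And>j. \<beta> j \<noteq> 0" and \<beta>d: "dominated (- m) \<beta>"
    and \<nu>: "\<And>p j. p \<in> F \<Longrightarrow> \<nu> p \<noteq> (of_int j)\<^sup>2"
    and \<nu>inj: "\<And>p q. p \<in> F \<Longrightarrow> q \<in> F \<Longrightarrow> p \<noteq> q \<Longrightarrow> (p < 0) = (q < 0) \<Longrightarrow> \<nu> p \<noteq> \<nu> q"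
    and "G \<subseteq> F"
  shows "\<exists>k c d \<beta>'. (\<forall>p\<in>F. dominated (- m - 2) (\<lambda>j. c j p)) \<and> (\<forall>p\<in>F. dominated (- m - 2) (\<lambda>j. d j p)) \<and>
    (\<forall>x. fin_rank F c (fin_rank F d x) = x) \<and> (\<forall>x. fin_rank F d (fin_rank F c x) = x) \<and>
    (\<forall>j. \<beta>' j \<noteq> 0) \<and> dominated (- m) \<beta>' \<and>
    (\<forall>x u. fin_rank F c (\<lambda>j. - (of_int j)\<^sup>2 * x j + \<beta> j * ((\<Sum>p\<in>F. k (j < 0) p * x p) + u (j < 0))) =
      (\<lambda>j. - (if j \<in> G then \<nu> j else (of_int j)\<^sup>2) * fin_rank F c x j + \<beta>' j * u (j < 0)))"
  using finite_subset[OF \<open>G \<subseteq> F\<close> F] \<open>G \<subseteq> F\<close>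
proof (induction G rule: finite_induct)
  case empty
  show ?case
    by (rule exI[of _ "\<lambda>_ _. 0"], rule exI[of _ "\<lambda>_ _. 0"], rule exI[of _ "\<lambda>_ _. 0"], rule exI[of _ \<beta>])
      (simp add: fin_rank_def dominated_zero \<beta>0 \<beta>d)
next
  case (insert p G)
  define M where "M = (\<lambda>j. if j \<in> G then \<nu> j else (of_int j)\<^sup>2)"
  have p: "p \<in> F" "p \<notin> G" "G \<subseteq> F" using insert by auto
  obtain k c d \<beta>' where c: "\<forall>p\<in>F. dominated (- m - 2) (\<lambda>j. c j p)" and d: "\<forall>p\<in>F. dominated (- m - 2) (\<lambda>j. d j p)"
    and cd: "\<And>x. fin_rank F c (fin_rank F d x) = x" and dc: "\<And>x. fin_rank F d (fin_rank F c x) = x"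
    and b: "\<And>j. \<beta>' j \<noteq> 0" and bd: "dominated (- m) \<beta>'"
    and E: "\<And>x u. fin_rank F c (\<lambda>j. - (of_int j)\<^sup>2 * x j + \<beta> j * ((\<Sum>p\<in>F. k (j < 0) p * x p) + u (j < 0))) =
      (\<lambda>j. - M j * fin_rank F c x j + \<beta>' j * u (j < 0))"
    using insert.IH[OF p(3)] unfolding M_def by blast
  define \<kappa> where "\<kappa> = \<nu> p - (of_int p)\<^sup>2"
  \<comment> \<open>The feedback enters through the control of the parity of \<open>p\<close>, so no
    mode of the other parity becomes coupled. Mode \<open>p\<close> itself is to be moved, not
    decoupled, hence \<open>\<gamma> p = 0\<close>.\<close>
  define \<gamma> where "\<gamma> j = (if j \<noteq> p \<and> (j < 0) = (p < 0) then \<beta>' j * (\<kappa> / \<beta>' p) * (1 / (M j - \<nu> p)) else 0)" for j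
  define e where "e j q = (if q = p then \<gamma> j else 0)" for j q
  \<comment> \<open>The new feedback acts on the transformed coordinate z_p. In the original
    coordinates this is row \<open>p\<close> of I + C, that is, the Kronecker delta plus
    \<open>c p q\<close>.\<close>
  define k' where "k' s q = k s q - (if s = (p < 0) then \<kappa> / \<beta>' p * ((if q = p then 1 else 0) + c p q) else 0)" for s q
  define b' where "b' j = \<beta>' j + \<gamma> j * \<beta>' p" for j
  have Mp: "M p = (of_int p)\<^sup>2" using p by (simp add: M_def)
  have \<gamma>p: "\<gamma> p = 0" by (simp add: \<gamma>_def)
  \<comment> \<open>The denominators of \<open>\<gamma>\<close> do not vanish: the target differs
    from the poles already placed in this parity, and from the squares still in place.\<close>
  have Mne: "M j \<noteq> \<nu> p" if "j \<noteq> p" "(j < 0) = (p < 0)" for j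
  proof (cases "j \<in> G")
    case True
    then show ?thesis using \<nu>inj[of j p] that p by (auto simp: M_def)
  next
    case False
    then show ?thesis using \<nu>[OF p(1), of j] by (simp add: M_def)
  qed
  \<comment> \<open>The old pole p^2 is simple in its parity: placed poles are not squares, and two
    indices of the same sign class with equal squares coincide.\<close>
  have Mne': "M j \<noteq> M p" if "j \<noteq> p" "(j < 0) = (p < 0)" for j
  proof (cases "j \<in> G")
    case True
    then show ?thesis using \<nu>[of j p] p by (auto simp: M_def)
  next
    case False
    have "j \<noteq> p \<and> j \<noteq> - p" using that by linarith
    then have "real_of_int j \<noteq> real_of_int p \<and> real_of_int j \<noteq> - real_of_int p"
      by (metis of_int_eq_iff of_int_minus)
    then have "(real_of_int j)\<^sup>2 \<noteq> (real_of_int p)\<^sup>2" by (simp add: power2_eq_iff)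
    then show ?thesis using False by (simp add: M_def p)
  qed
  have "dominated (- m - 2) (\<lambda>j. \<beta>' j * (\<kappa> / \<beta>' p) * (1 / (M j - \<nu> p)))"
  proof -
    have "dominated (- m) (\<lambda>j. (\<kappa> / \<beta>' p) * \<beta>' j)" by (intro dominated_const_mult bd)
    moreover have "dominated (- 2) (\<lambda>j. 1 / (M j - \<nu> p))"
      by (rule dominated_resolvent[OF F]) (use p in \<open>auto simp: M_def\<close>)
    ultimately have "dominated (- m + - 2) (\<lambda>j. (\<kappa> / \<beta>' p) * \<beta>' j * (1 / (M j - \<nu> p)))" by (rule dominated_mult)
    then show ?thesis by (simp add: mult_ac)
  qed
  from dominated_nonneg[OF this] obtain B where "B \<ge> 0"
    and B: "\<And>j. \<bar>\<beta>' j * (\<kappa> / \<beta>' p) * (1 / (M j - \<nu> p))\<bar> \<le> B * wt (- m - 2) j" by blast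
  have "\<bar>\<gamma> j\<bar> \<le> B * wt (- m - 2) j" for j
    using B[of j] \<open>B \<ge> 0\<close> unfolding \<gamma>_def by (simp add: less_imp_le)
  then have \<gamma>d: "dominated (- m - 2) \<gamma>"
    unfolding dominated_def by blast
  have ed: "\<forall>q\<in>F. dominated (- m - 2) (\<lambda>j. e j q)" "\<forall>q\<in>F. dominated (- m - 2) (\<lambda>j. - e j q)"
  proof -
    have "dominated (- m - 2) (\<lambda>j. e j q)" for q
      using \<gamma>d by (cases "q = p") (simp_all add: e_def dominated_zero)
    then show "\<forall>q\<in>F. dominated (- m - 2) (\<lambda>j. e j q)" "\<forall>q\<in>F. dominated (- m - 2) (\<lambda>j. - e j q)"
      using dominated_const_mult[of _ _ "-1"] by simp_all
  qed
  have e: "fin_rank F e z j = z j + \<gamma> j * z p" "fin_rank F (\<lambda>j q. - e j q) z j = z j - \<gamma> j * z p" for z j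
  proof -
    have "(\<Sum>q\<in>F. e j q * z q) = (\<Sum>q\<in>F. if q = p then \<gamma> j * z q else 0)"
      by (rule sum.cong) (auto simp: e_def)
    then have "(\<Sum>q\<in>F. e j q * z q) = \<gamma> j * z p" using F p(1) by simp
    then show "fin_rank F e z j = z j + \<gamma> j * z p" "fin_rank F (\<lambda>j q. - e j q) z j = z j - \<gamma> j * z p"
      by (simp_all add: fin_rank_def sum_negf)
  qed
  \<comment> \<open>Since \<open>\<gamma> p = 0\<close>, the rank-one part has square zero, and
    changing its sign inverts the transformation.\<close>
  have ee: "fin_rank F e (fin_rank F (\<lambda>j q. - e j q) z) = z" "fin_rank F (\<lambda>j q. - e j q) (fin_rank F e z) = z" for z
    by (auto simp: fun_eq_iff e \<gamma>p)
  have k': "(\<Sum>q\<in>F. k' s q * x q) = (\<Sum>q\<in>F. k s q * x q) - (if s = (p < 0) then \<kappa> / \<beta>' p * fin_rank F c x p else 0)" for s x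
  proof -
    have "(\<Sum>q\<in>F. (if q = p then 1 else 0) * x q) = (\<Sum>q\<in>F. if q = p then x q else 0)"
      by (rule sum.cong) auto
    then have "fin_rank F c x p = (\<Sum>q\<in>F. ((if q = p then 1 else 0) + c p q) * x q)"
      using F p(1) by (simp add: fin_rank_def distrib_right sum.distrib)
    then show ?thesis
      by (cases "s = (p < 0)") (simp_all add: k'_def left_diff_distrib sum_subtractf sum_distrib_left mult.assoc)
  qed
  have \<gamma>eq: "\<gamma> j * (M j - \<nu> p) = \<beta>' j * (\<kappa> / \<beta>' p)" if "j \<noteq> p" "(j < 0) = (p < 0)" for j
    using Mne[OF that] that by (simp add: \<gamma>_def)
  \<comment> \<open>Multiplying by \<open>M j - \<nu> p\<close> turns the new input coefficient into
    \<open>\<beta>' j * (M j - M p)\<close>, which is nonzero by simplicity. This keeps the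
    remaining poles movable.\<close>
  have b'0: "b' j \<noteq> 0" for j
  proof (cases "j \<noteq> p \<and> (j < 0) = (p < 0)")
    case True
    have "b' j * (M j - \<nu> p) = \<beta>' j * (M j - \<nu> p) + \<gamma> j * (M j - \<nu> p) * \<beta>' p"
      by (simp add: b'_def algebra_simps)
    also have "\<gamma> j * (M j - \<nu> p) = \<beta>' j * (\<kappa> / \<beta>' p)" using True by (intro \<gamma>eq) auto
    also have "\<beta>' j * (M j - \<nu> p) + \<beta>' j * (\<kappa> / \<beta>' p) * \<beta>' p = \<beta>' j * (M j - M p)"
      using b[of p] by (simp add: \<kappa>_def Mp field_simps)
    finally show ?thesis using b[of j] Mne'[of j] True by auto
  qed (use b in \<open>auto simp: b'_def \<gamma>_def\<close>)
  have "dominated (- m) (\<lambda>j. \<beta>' j + \<beta>' p * \<gamma> j)"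
    by (intro dominated_add bd dominated_const_mult dominated_mono[OF \<gamma>d]) simp
  then have b'd: "dominated (- m) b'" by (simp add: b'_def[abs_def] mult.commute)
  have main: "fin_rank F (fin_rank_comp F e c)
        (\<lambda>j. - (of_int j)\<^sup>2 * x j + \<beta> j * ((\<Sum>p\<in>F. k' (j < 0) p * x p) + u (j < 0))) =
      (\<lambda>j. - (if j \<in> insert p G then \<nu> j else (of_int j)\<^sup>2) * fin_rank F (fin_rank_comp F e c) x j + b' j * u (j < 0))" for x u
  proof
    fix j
    define z where "z = fin_rank F c x"
    \<comment> \<open>The induction hypothesis holds for an arbitrary input, so the feedback that
      moves pole \<open>p\<close> can be hidden in the input.\<close>
    define u' where "u' = (\<lambda>s. u s - (if s = (p < 0) then \<kappa> / \<beta>' p * z p else 0))"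
    have "fin_rank F c (\<lambda>j. - (of_int j)\<^sup>2 * x j + \<beta> j * ((\<Sum>p\<in>F. k' (j < 0) p * x p) + u (j < 0))) =
        fin_rank F c (\<lambda>j. - (of_int j)\<^sup>2 * x j + \<beta> j * ((\<Sum>p\<in>F. k (j < 0) p * x p) + u' (j < 0)))"
      by (simp only: k' u'_def z_def diff_add_eq add_diff_eq)
    also have "\<dots> = (\<lambda>j. - M j * z j + \<beta>' j * u' (j < 0))" using E z_def by simp
    finally have Z: "fin_rank F (fin_rank_comp F e c) (\<lambda>j. - (of_int j)\<^sup>2 * x j + \<beta> j * ((\<Sum>p\<in>F. k' (j < 0) p * x p) + u (j < 0))) j
        = (- M j * z j + \<beta>' j * u' (j < 0)) + \<gamma> j * (- M p * z p + \<beta>' p * u' (p < 0))" (is "?L = _")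
      by (simp add: fin_rank_fin_rank[symmetric] e)
    have up: "\<beta>' p * u' (p < 0) = \<beta>' p * u (p < 0) - \<kappa> * z p"
      using b[of p] by (simp add: u'_def right_diff_distrib)
    have R: "fin_rank F (fin_rank_comp F e c) x j = z j + \<gamma> j * z p"
      by (simp add: fin_rank_fin_rank[symmetric] e z_def)
    \<comment> \<open>Mode \<open>p\<close> receives the displacement \<open>\<kappa>\<close>; in
      the other modes of its parity \<open>\<gamma>eq\<close> cancels the coupling; the other parity
      sees neither \<open>\<gamma>\<close> nor the new feedback.\<close>
    consider "j = p" | "j \<noteq> p" "(j < 0) = (p < 0)" | "j \<noteq> p" "(j < 0) \<noteq> (p < 0)" by blast
    then show "?L = - (if j \<in> insert p G then \<nu> j else (of_int j)\<^sup>2) * fin_rank F (fin_rank_comp F e c) x j + b' j * u (j < 0)"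
      unfolding Z R
    proof cases
      case 1
      then show "(- M j * z j + \<beta>' j * u' (j < 0)) + \<gamma> j * (- M p * z p + \<beta>' p * u' (p < 0)) =
          - (if j \<in> insert p G then \<nu> j else (of_int j)\<^sup>2) * (z j + \<gamma> j * z p) + b' j * u (j < 0)"
        by (simp add: \<gamma>p b'_def up Mp \<kappa>_def algebra_simps)
    next
      case 2
      have M': "(if j \<in> insert p G then \<nu> j else (of_int j)\<^sup>2) = M j" using 2 by (simp add: M_def)
      have "\<beta>' j * u' (j < 0) = \<beta>' j * u (j < 0) - \<gamma> j * (M j - \<nu> p) * z p"
        unfolding \<gamma>eq[OF 2] using 2(2) by (simp add: u'_def right_diff_distrib)
      then show "(- M j * z j + \<beta>' j * u' (j < 0)) + \<gamma> j * (- M p * z p + \<beta>' p * u' (p < 0)) =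
          - (if j \<in> insert p G then \<nu> j else (of_int j)\<^sup>2) * (z j + \<gamma> j * z p) + b' j * u (j < 0)"
        unfolding M' up using 2 by (simp add: b'_def Mp \<kappa>_def algebra_simps)
    next
      case 3
      then have "\<gamma> j = 0" "u' (j < 0) = u (j < 0)" by (auto simp: \<gamma>_def u'_def)
      then show "(- M j * z j + \<beta>' j * u' (j < 0)) + \<gamma> j * (- M p * z p + \<beta>' p * u' (p < 0)) =
          - (if j \<in> insert p G then \<nu> j else (of_int j)\<^sup>2) * (z j + \<gamma> j * z p) + b' j * u (j < 0)"
        using 3 by (simp add: b'_def M_def)
    qed
  qed
  show ?case
  proof (rule exI[of _ k'], rule exI[of _ "fin_rank_comp F e c"],
      rule exI[of _ "fin_rank_comp F d (\<lambda>j q. - e j q)"], rule exI[of _ b'], intro conjI allI)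
    show "\<forall>q\<in>F. dominated (- m - 2) (\<lambda>j. fin_rank_comp F e c j q)"
      by (rule dominated_fin_rank_comp[OF ed(1) c])
    show "\<forall>q\<in>F. dominated (- m - 2) (\<lambda>j. fin_rank_comp F d (\<lambda>j q. - e j q) j q)"
      by (rule dominated_fin_rank_comp[OF d ed(2)])
  qed (simp_all only: fin_rank_fin_rank[symmetric] cd dc ee b'0 b'd main[unfolded fin_rank_fin_rank[symmetric]] not_False_eq_True)
qed

section \<open>Scalar weak derivatives\<close>

definition smooth :: "(real \<Rightarrow> real) \<Rightarrow> bool" where
  "smooth f \<longleftrightarrow> (\<forall>k. (deriv ^^ k) f differentiable_on UNIV)"

text \<open>An invariant class closed under differentiation replaces explicit formulas for higher
  derivatives.\<close>

lemma smooth_coinduct: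
  assumes "A f" and step: "\<And>g. A g \<Longrightarrow> g differentiable_on UNIV \<and> A (deriv g)"
  shows "smooth f"
proof -
  have "A ((deriv ^^ k) f)" for k
    by (induction k) (use assms in auto)
  then show ?thesis using step by (auto simp: smooth_def)
qed

text \<open>The classical flat function exp(-1/x), multiplied by the negative powers that its
  derivatives create: over all \<open>k\<close> the family is closed under differentiation up to
  linear combinations.\<close>

definition flat :: "nat \<Rightarrow> real \<Rightarrow> real" where
  "flat k x = (if x > 0 then (1 / x) ^ k * exp (- (1 / x)) else 0)"

lemma flat_deriv: "(flat k has_real_derivative flat (k + 2) x - k * flat (k + 1) x) (at x)"
proof -
  consider "x > 0" | "x < 0" | "x = 0" by linarith
  then show ?thesis
  proof cases
    case 1
    have inv: "((\<lambda>x. 1 / x) has_real_derivative - ((1 / x) * (1 / x))) (at x)"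
      using 1 by (auto intro!: derivative_eq_intros simp: field_simps)
    have gen: "((\<lambda>x. g x ^ k * exp (- g x)) has_real_derivative
        real k * g x ^ (k - 1) * - (g x * g x) * exp (- g x) + g x ^ k * (exp (- g x) * (g x * g x))) (at x)"
      if "(g has_real_derivative - (g x * g x)) (at x)" for g
      using that by (auto intro!: derivative_eq_intros simp: algebra_simps)
    have "((\<lambda>x. (1 / x) ^ k * exp (- (1 / x))) has_real_derivative
        real k * (1 / x) ^ (k - 1) * - ((1 / x) * (1 / x)) * exp (- (1 / x)) +
        (1 / x) ^ k * (exp (- (1 / x)) * ((1 / x) * (1 / x)))) (at x)"
      using gen[OF inv] .
    \<comment> \<open>For \<open>k = 0\<close> the truncated exponent \<open>k - 1\<close> is
      harmless, because the factor \<open>real k\<close> vanishes.\<close>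
    moreover have "real k * y ^ (k - 1) * - (y * y) * e + y ^ k * (e * (y * y)) =
        y ^ (k + 2) * e - k * (y ^ (k + 1) * e)" for y e :: real
      by (cases k) (simp_all add: algebra_simps)
    ultimately have "((\<lambda>x. (1 / x) ^ k * exp (- (1 / x))) has_real_derivative
        flat (k + 2) x - k * flat (k + 1) x) (at x)"
      unfolding flat_def if_P[OF 1] by metis
    then show ?thesis
      by (rule has_field_derivative_transform_within_open[of _ _ _ "{0<..}"]) (use 1 in \<open>auto simp: flat_def\<close>)
  next
    case 2
    have "((\<lambda>x. 0) has_real_derivative flat (k + 2) x - k * flat (k + 1) x) (at x)"
      using 2 by (simp add: flat_def)
    then show ?thesis
      by (rule has_field_derivative_transform_within_open[of _ _ _ "{..<0}"]) (use 2 in \<open>auto simp: flat_def\<close>)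
  next
    case 3
    \<comment> \<open>With y = 1/h the right difference quotient at 0 is y^(k+1) / exp y, which
      tends to 0.\<close>
    have "((\<lambda>y. y ^ (k + 1) / exp y) \<longlongrightarrow> 0) (at_top :: real filter)"
      by (rule tendsto_power_div_exp_0)
    then have "((\<lambda>h. (inverse h) ^ (k + 1) / exp (inverse h)) \<longlongrightarrow> (0::real)) (at_right 0)"
      by (rule filterlim_compose) (rule filterlim_inverse_at_top_right)
    moreover have "\<forall>\<^sub>F h in at_right 0. (inverse h) ^ (k + 1) / exp (inverse h) = flat k h / (h::real)"
      by (rule eventually_at_rightI[of 0 1]) (auto simp: flat_def exp_minus field_simps)
    ultimately have R: "((\<lambda>h. flat k h / h) \<longlongrightarrow> 0) (at_right 0)"
      by (rule Lim_transform_eventually)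
    have L: "((\<lambda>h. flat k h / h) \<longlongrightarrow> 0) (at_left 0)"
      by (rule Lim_transform_eventually[OF tendsto_const])
        (auto simp: flat_def eventually_at_filter intro!: always_eventually)
    from L R have "((\<lambda>h. flat k h / h) \<longlongrightarrow> 0) (at 0)"
      by (simp add: filterlim_split_at)
    then show ?thesis using 3 by (simp add: has_field_derivative_iff flat_def)
  qed
qed

text \<open>A class closed under differentiation that contains the bumps; affine arguments provide
  their translations and reflections.\<close>

inductive flat_algebra :: "(real \<Rightarrow> real) \<Rightarrow> bool" where
  const: "flat_algebra (\<lambda>x. a)"
| flat: "flat_algebra (\<lambda>x. flat k (a + s * x))"
| add: "flat_algebra f \<Longrightarrow> flat_algebra g \<Longrightarrow> flat_algebra (\<lambda>x. f x + g x)"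
| mult: "flat_algebra f \<Longrightarrow> flat_algebra g \<Longrightarrow> flat_algebra (\<lambda>x. f x * g x)"

lemma flat_algebra_deriv:
  "flat_algebra f \<Longrightarrow> \<exists>g. flat_algebra g \<and> (\<forall>x. (f has_real_derivative g x) (at x))"
proof (induction rule: flat_algebra.induct)
  case (const a)
  have "flat_algebra (\<lambda>x. 0) \<and> (\<forall>x. ((\<lambda>x. a) has_real_derivative 0) (at x))"
    by (simp add: flat_algebra.const)
  then show ?case by (intro exI[of _ "\<lambda>x. 0"]) auto
next
  case (flat k a s)
  have "flat_algebra (\<lambda>x. s * (flat (k + 2) (a + s * x) + (- real k) * flat (k + 1) (a + s * x)))"
    by (intro flat_algebra.intros)
  moreover have "((\<lambda>x. flat k (a + s * x)) has_real_derivative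
      s * (flat (k + 2) (a + s * x) + (- real k) * flat (k + 1) (a + s * x))) (at x)" for x
    by (rule DERIV_chain2[OF flat_deriv, THEN DERIV_cong]) (auto intro!: derivative_eq_intros)
  ultimately show ?case
    by (intro exI[of _ "\<lambda>x. s * (flat (k + 2) (a + s * x) + (- real k) * flat (k + 1) (a + s * x))"]) blast
next
  case (add f g)
  then obtain f' g' where "flat_algebra f'" "flat_algebra g'"
    and "\<And>x. (f has_real_derivative f' x) (at x)" "\<And>x. (g has_real_derivative g' x) (at x)" by blast
  then show ?case
    by (intro exI[of _ "\<lambda>x. f' x + g' x"]) (auto intro!: flat_algebra.intros derivative_intros)
next
  case (mult f g)
  then obtain f' g' where 1: "flat_algebra f'" "flat_algebra g'"
    and 2: "\<And>x. (f has_real_derivative f' x) (at x)" "\<And>x. (g has_real_derivative g' x) (at x)" by blast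
  have "((\<lambda>x. f x * g x) has_real_derivative f' x * g x + g' x * f x) (at x)" for x
    by (rule DERIV_mult[OF 2])
  then show ?case
    using mult 1 by (intro exI[of _ "\<lambda>x. f' x * g x + g' x * f x"]) (auto intro!: flat_algebra.intros)
qed

lemma flat_algebra_smooth: "flat_algebra f \<Longrightarrow> smooth f"
proof (rule smooth_coinduct[of flat_algebra])
  fix g assume "flat_algebra g"
  then obtain g' where g': "flat_algebra g'" "\<And>x. (g has_real_derivative g' x) (at x)"
    using flat_algebra_deriv by blast
  then have "deriv g = g'" by (auto intro: DERIV_imp_deriv)
  moreover have "g differentiable_on UNIV"
    using g'(2) by (auto simp: differentiable_on_def real_differentiable_def)
  ultimately show "g differentiable_on UNIV \<and> flat_algebra (deriv g)" using g' by simp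
qed

definition bump :: "real \<Rightarrow> real \<Rightarrow> real" where
  "bump e x = flat 0 (e + x) * flat 0 (e - x)"

lemma bump_pos: "\<bar>x\<bar> < e \<Longrightarrow> bump e x > 0"
  by (auto simp: bump_def flat_def)

lemma bump_zero: "\<bar>x\<bar> \<ge> e \<Longrightarrow> bump e x = 0"
  by (auto simp: bump_def flat_def)

lemma bump_nonneg: "bump e x \<ge> 0"
  by (auto simp: bump_def flat_def)

lemma flat_algebra_bump: "flat_algebra (\<lambda>x. bump e (x - a))"
proof -
  have "flat_algebra (\<lambda>x. flat 0 ((e - a) + 1 * x) * flat 0 ((e + a) + (-1) * x))"
    by (intro flat_algebra.intros)
  then show ?thesis by (simp add: bump_def algebra_simps)
qed

lemma continuous_flat_algebra: "flat_algebra f \<Longrightarrow> continuous_on S f"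
  using flat_algebra_deriv by (metis DERIV_isCont continuous_at_imp_continuous_on)

section \<open>Test functions, integration by parts and the du Bois-Reymond lemma\<close>

lemma test_function_deriv:
  "test_function \<phi> \<Longrightarrow> (\<phi> has_real_derivative deriv \<phi> t) (at t)"
  unfolding test_function_def
  by (metis DERIV_deriv_iff_real_differentiable UNIV_I differentiable_on_def funpow_0)

lemma test_function_continuous_deriv: "test_function \<phi> \<Longrightarrow> continuous_on S (deriv \<phi>)"
proof -
  assume "test_function \<phi>"
  then have "(deriv ^^ 1) \<phi> differentiable_on UNIV" unfolding test_function_def by blast
  then have "continuous_on UNIV (deriv \<phi>)"
    using differentiable_imp_continuous_on[of "deriv \<phi>" UNIV] by simp
  then show ?thesis by (rule continuous_on_subset) simp
qed

lemma test_function_continuous: "test_function \<phi> \<Longrightarrow> continuous_on S \<phi>"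
  using test_function_deriv by (metis DERIV_isCont continuous_at_imp_continuous_on)

text \<open>The interval is open so that the function also vanishes at \<open>a\<close> and
  \<open>b\<close>, which kills the boundary terms of an integration by parts. Off the support the
  derivative vanishes because the complement of a compact set is open.\<close>

lemma test_function_support:
  assumes "test_function \<phi>"
  shows "\<exists>a b. 0 < a \<and> a \<le> b \<and> (\<forall>t. t \<notin> {a<..<b} \<longrightarrow> \<phi> t = 0 \<and> deriv \<phi> t = 0)"
proof -
  obtain J where J: "compact J" "J \<subseteq> {0<..}" "\<And>t. t \<notin> J \<Longrightarrow> \<phi> t = 0"
    using assms unfolding test_function_def by blast
  have "\<exists>a b. 0 < a \<and> a \<le> b \<and> J \<subseteq> {a<..<b}"
  proof (cases "J = {}")
    case True
    then show ?thesis by (intro exI[of _ 1]) auto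
  next
    case False
    then obtain l u where lu: "l \<in> J" "\<And>x. x \<in> J \<Longrightarrow> l \<le> x" "u \<in> J" "\<And>x. x \<in> J \<Longrightarrow> x \<le> u"
      using compact_attains_inf[OF J(1)] compact_attains_sup[OF J(1)] by metis
    have "0 < l" using lu(1) J(2) by auto
    have "x \<in> {l/2<..<u+1}" if "x \<in> J" for x
      using lu(2)[OF that] lu(4)[OF that] \<open>0 < l\<close> by simp
    moreover have "l / 2 \<le> u + 1" using lu(2)[OF lu(3)] \<open>0 < l\<close> by simp
    ultimately show ?thesis
      using \<open>0 < l\<close> by (intro exI[of _ "l/2"] exI[of _ "u+1"]) auto
  qed
  then obtain a b where ab: "0 < a" "a \<le> b" "J \<subseteq> {a<..<b}" by blast
  have "deriv \<phi> t = 0" if "t \<notin> J" for t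
  proof -
    have "open (- J)" using J(1) compact_imp_closed by auto
    have "(\<phi> has_real_derivative 0) (at t)"
      by (rule has_field_derivative_transform_within_open[OF DERIV_const \<open>open (- J)\<close>])
        (use that J(3) in auto)
    then show ?thesis by (rule DERIV_imp_deriv)
  qed
  with J(3) ab show ?thesis by blast
qed

text \<open>Bridge from the Lebesgue integral in \<open>weak_deriv\<close> to the gauge integral,
  for which the fundamental theorem of calculus is available.\<close>

lemma lebesgue_integral_compact_support:
  fixes f :: "real \<Rightarrow> real"
  assumes "continuous_on {0<..} f" "0 < a" "\<And>t. t \<notin> {a..b} \<Longrightarrow> f t = 0"
  shows "integrable (lebesgue_on {0<..}) f" (is ?I)
    and "(LINT t|lebesgue_on {0<..}. f t) = integral {a..b} f" (is ?E)
proof -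
  have "continuous_on {a..b} f"
    by (rule continuous_on_subset[OF assms(1)]) (use assms(2) in auto)
  then have ai: "f absolutely_integrable_on {a..b}" by (rule absolutely_integrable_continuous_real)
  have eq: "(\<lambda>t. indicator {0<..} t *\<^sub>R f t) = (\<lambda>t. indicator {a..b} t *\<^sub>R f t)"
    using assms(2,3) by (force simp: indicator_def)
  have s: "{0<..} \<inter> space lebesgue \<in> sets (lebesgue :: real measure)" by simp
  show ?I
    using ai unfolding integrable_restrict_space[OF s] eq set_integrable_def .
  show ?E
    using set_lebesgue_integral_eq_integral(2)[OF ai]
    unfolding integral_restrict_space[OF s] eq set_lebesgue_integral_def .
qed

lemma integrable_test_mult:
  assumes "test_function \<phi>" "continuous_on {0<..} f"
  shows "integrable (lebesgue_on {0<..}) (\<lambda>t. \<phi> t * f t)"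
    and "integrable (lebesgue_on {0<..}) (\<lambda>t. deriv \<phi> t * f t)"
proof -
  obtain a b where ab: "0 < a" "a \<le> b" "\<And>t. t \<notin> {a<..<b} \<Longrightarrow> \<phi> t = 0"
    "\<And>t. t \<notin> {a<..<b} \<Longrightarrow> deriv \<phi> t = 0"
    using test_function_support[OF assms(1)] by metis
  have "\<phi> t * f t = 0 \<and> deriv \<phi> t * f t = 0" if "t \<notin> {a..b}" for t
    using ab(3)[of t] ab(4)[of t] that by force
  then show "integrable (lebesgue_on {0<..}) (\<lambda>t. \<phi> t * f t)"
    and "integrable (lebesgue_on {0<..}) (\<lambda>t. deriv \<phi> t * f t)"
    by (intro lebesgue_integral_compact_support(1)[of _ a b] continuous_on_mult ab(1) assms(2)
        test_function_continuous[OF assms(1)] test_function_continuous_deriv[OF assms(1)]; blast)+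
qed

text \<open>Integration by parts: the integrand \<open>?F\<close> is the derivative of the product
  of \<open>\<phi>\<close> and \<open>h\<close>, and \<open>\<phi>\<close> is zero at both
  ends.\<close>

lemma weak_deriv_classical:
  assumes \<phi>: "test_function \<phi>" and h: "\<And>t. t > 0 \<Longrightarrow> (h has_real_derivative g t) (at t)"
    and g: "continuous_on {0<..} g"
  shows "(LINT t|lebesgue_on {0<..}. deriv \<phi> t * h t) = - (LINT t|lebesgue_on {0<..}. \<phi> t * g t)"
proof -
  have ch: "continuous_on {0<..} h"
    by (metis DERIV_isCont continuous_at_imp_continuous_on greaterThan_iff h)
  obtain a b where ab: "0 < a" "a \<le> b" "\<And>t. t \<notin> {a<..<b} \<Longrightarrow> \<phi> t = 0"
    "\<And>t. t \<notin> {a<..<b} \<Longrightarrow> deriv \<phi> t = 0"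
    using test_function_support[OF \<phi>] by metis
  let ?F = "\<lambda>t. deriv \<phi> t * h t + \<phi> t * g t"
  have "(?F has_integral \<phi> b * h b - \<phi> a * h a) {a..b}"
  proof (rule fundamental_theorem_of_calculus[OF ab(2)])
    fix t assume "t \<in> {a..b}"
    then have "((\<lambda>t. \<phi> t * h t) has_real_derivative deriv \<phi> t * h t + g t * \<phi> t) (at t)"
      using ab(1) by (intro DERIV_mult test_function_deriv[OF \<phi>] h) simp
    then show "((\<lambda>t. \<phi> t * h t) has_vector_derivative ?F t) (at t within {a..b})"
      by (simp add: has_real_derivative_iff_has_vector_derivative has_vector_derivative_at_within mult.commute)
  qed
  then have "integral {a..b} ?F = 0" using ab(3)[of a] ab(3)[of b] by (simp add: integral_unique)
  moreover have "(LINT t|lebesgue_on {0<..}. ?F t) = integral {a..b} ?F"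
  proof (rule lebesgue_integral_compact_support(2)[OF _ ab(1)])
    show "continuous_on {0<..} ?F"
      by (intro continuous_intros ch g test_function_continuous[OF \<phi>] test_function_continuous_deriv[OF \<phi>])
    show "?F t = 0" if "t \<notin> {a..b}" for t
      using ab(3)[of t] ab(4)[of t] that by force
  qed
  moreover have "(LINT t|lebesgue_on {0<..}. ?F t) =
      (LINT t|lebesgue_on {0<..}. deriv \<phi> t * h t) + (LINT t|lebesgue_on {0<..}. \<phi> t * g t)"
    by (rule Bochner_Integration.integral_add) (fact integrable_test_mult(2)[OF \<phi> ch] integrable_test_mult(1)[OF \<phi> g])+
  ultimately show ?thesis by linarith
qed

text \<open>Tested with an antiderivative of (bump at \<open>a\<close>) \<open>-\<close> (bump at \<open>b\<close>), which has compact support because the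
  two bumps have equal mass.\<close>

lemma weak_deriv_zero_not_less:
  fixes h :: "real \<Rightarrow> real"
  assumes h: "continuous_on {0<..} h"
    and w: "\<And>\<phi>. test_function \<phi> \<Longrightarrow> (LINT t|lebesgue_on {0<..}. deriv \<phi> t * h t) = 0"
    and ab: "a > 0" "b > 0"
  shows "\<not> h a < h b"
proof
  assume less: "h a < h b"
  define c where "c = (h a + h b) / 2"
  have c: "h a < c" "c < h b" using less by (auto simp: c_def)
  have "isCont h a" "isCont h b" using h ab by (auto simp: continuous_on_eq_continuous_at)
  then have "\<forall>\<^sub>F x in nhds a. h x < c" "\<forall>\<^sub>F x in nhds b. c < h x"
    using c unfolding isCont_def tendsto_at_iff_tendsto_nhds by (metis order_tendstoD)+
  then obtain d1 d2 where d: "d1 > 0" "\<And>x. \<bar>x - a\<bar> < d1 \<Longrightarrow> h x < c" "d2 > 0" "\<And>x. \<bar>x - b\<bar> < d2 \<Longrightarrow> c < h x"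
    unfolding eventually_nhds_metric dist_real_def by metis
  \<comment> \<open>Within this radius \<open>h\<close> stays below \<open>c\<close> near
    \<open>a\<close> and above \<open>c\<close> near \<open>b\<close>, so the two bumps have
    disjoint supports up to endpoints; the part \<open>min a b / 2\<close> keeps both supports
    inside the positive half-line.\<close>
  define e where "e = min (min d1 d2) (min a b / 2)"
  have e: "0 < e" "e < a" "e < b" "\<And>x. \<bar>x - a\<bar> < e \<Longrightarrow> h x < c" "\<And>x. \<bar>x - b\<bar> < e \<Longrightarrow> c < h x"
    using d ab by (auto simp: e_def)
  have fb: "flat_algebra (bump e)" using flat_algebra_bump[of e 0] by simp
  obtain P where P: "\<And>x. (P has_real_derivative bump e x) (at x)"
  proof -
    have "\<exists>P. \<forall>x. (- \<infinity> :: ereal) < x \<longrightarrow> x < (\<infinity> :: ereal) \<longrightarrow> (P has_vector_derivative bump e x) (at x)"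
      by (rule einterval_antiderivative)
       (use continuous_flat_algebra[OF fb, of UNIV] in \<open>auto simp: continuous_on_eq_continuous_at\<close>)
    then show ?thesis using that by (auto simp: has_real_derivative_iff_has_vector_derivative)
  qed
  have P0: "(P has_real_derivative 0) (at x within S)" if "\<bar>x\<bar> \<ge> e" for x S
    using P[of x] bump_zero[OF that] by (simp add: has_field_derivative_at_within)
  have Pr: "P x = P y" if "e \<le> x" "e \<le> y" for x y
  proof -
    have "\<exists>k. \<forall>x\<in>{e..}. P x = k"
      by (rule has_field_derivative_zero_constant) (simp_all add: P0)
    then show ?thesis using that by auto
  qed
  have Pl: "P x = P y" if "x \<le> - e" "y \<le> - e" for x y
  proof -
    have "\<exists>k. \<forall>x\<in>{..-e}. P x = k"
      by (rule has_field_derivative_zero_constant) (simp_all add: P0)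
    then show ?thesis using that by auto
  qed
  define \<phi> where "\<phi> = (\<lambda>x. P (x - a) - P (x - b))"
  define \<rho> where "\<rho> = (\<lambda>x. bump e (x - a) - bump e (x - b))"
  define lo hi where "lo = min a b - e" and "hi = max a b + e"
  have d\<phi>: "(\<phi> has_real_derivative \<rho> x) (at x)" for x
    unfolding \<phi>_def \<rho>_def by (auto intro!: derivative_eq_intros DERIV_chain2[OF P])
  then have D: "deriv \<phi> = \<rho>" by (auto intro: DERIV_imp_deriv)
  have fr: "flat_algebra \<rho>"
  proof -
    have "flat_algebra (\<lambda>x. bump e (x - a) + (-1) * bump e (x - b))"
      by (intro flat_algebra.intros flat_algebra_bump)
    then show ?thesis by (simp add: \<rho>_def)
  qed
  \<comment> \<open>Left or right of both bumps the two arguments of \<open>P\<close> lie on the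
    same side of [-e, e], where \<open>P\<close> is constant, so the values cancel.\<close>
  have z\<phi>: "\<phi> x = 0" if "x \<notin> {lo..hi}" for x
    using that Pr[of "x - a" "x - b"] Pl[of "x - a" "x - b"] by (auto simp: \<phi>_def lo_def hi_def)
  have z\<rho>: "\<rho> x = 0" if "x \<notin> {lo..hi}" for x
    using that by (auto simp: \<rho>_def lo_def hi_def bump_zero)
  have lo: "0 < lo" "lo < hi" using e(1-3) by (auto simp: lo_def hi_def min_def max_def)
  have tf: "test_function \<phi>"
    unfolding test_function_def
  proof
    show "\<forall>k. (deriv ^^ k) \<phi> differentiable_on UNIV"
    proof
      fix k show "(deriv ^^ k) \<phi> differentiable_on UNIV"
      proof (cases k)
        case 0
        then show ?thesis using d\<phi> by (auto simp: differentiable_on_def real_differentiable_def)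
      next
        case (Suc k')
        have "(deriv ^^ k) \<phi> = (deriv ^^ k') \<rho>"
          by (simp add: Suc funpow_swap1 D del: funpow.simps(2)) (simp add: D funpow_Suc_right del: funpow.simps(2))
        then show ?thesis using flat_algebra_smooth[OF fr] by (simp add: smooth_def)
      qed
    qed
    show "\<exists>J. compact J \<and> J \<subseteq> {0<..} \<and> (\<forall>t. t \<notin> J \<longrightarrow> \<phi> t = 0)"
      by (rule exI[of _ "{lo..hi}"]) (use lo z\<phi> in auto)
  qed
  \<comment> \<open>Constants have zero weak derivative too, so \<open>h\<close> may be replaced by
    \<open>c - h\<close>. Its sign agrees with that of \<open>\<rho>\<close> on both bumps, so the
    integrand is nonnegative although its integral is zero.\<close>
  have "(LINT t|lebesgue_on {0<..}. deriv \<phi> t * c) = 0"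
    using weak_deriv_classical[OF tf, of "\<lambda>_. c" "\<lambda>_. 0"] by simp
  then have "(LINT t|lebesgue_on {0<..}. deriv \<phi> t * c - deriv \<phi> t * h t) = 0"
    using w[OF tf] integrable_test_mult(2)[OF tf continuous_on_const] integrable_test_mult(2)[OF tf h]
    by (subst Bochner_Integration.integral_diff) auto
  then have z: "(LINT t|lebesgue_on {0<..}. \<rho> t * (c - h t)) = 0" by (simp add: D right_diff_distrib)
  have cont: "continuous_on {0<..} (\<lambda>t. \<rho> t * (c - h t))"
    by (intro continuous_intros h continuous_flat_algebra[OF fr])
  have "integral {lo..hi} (\<lambda>t. \<rho> t * (c - h t)) = 0"
    using lebesgue_integral_compact_support(2)[OF cont lo(1)] z\<rho> z by simp
  moreover have "\<rho> t * (c - h t) \<ge> 0" for t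
  proof (cases "\<bar>t - a\<bar> < e")
    case True
    then have "\<not> \<bar>t - b\<bar> < e" using e(4,5) by (meson less_asym)
    then show ?thesis using e(4)[OF True] bump_nonneg[of e "t - a"] by (simp add: \<rho>_def bump_zero)
  next
    case False
    then have eq: "\<rho> t = - bump e (t - b)" by (simp add: \<rho>_def bump_zero)
    show ?thesis
    proof (cases "\<bar>t - b\<bar> < e")
      case True
      then show ?thesis using e(5)[OF True] bump_nonneg[of e "t - b"] by (simp add: eq mult_nonneg_nonpos)
    qed (simp add: eq bump_zero)
  qed
  moreover have "continuous_on {lo..hi} (\<lambda>t. \<rho> t * (c - h t))"
    by (rule continuous_on_subset[OF cont]) (use lo in auto)
  ultimately have "\<forall>t\<in>{lo..hi}. \<rho> t * (c - h t) = 0"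
    using integral_cbox_eq_0_iff[of lo hi "\<lambda>t. \<rho> t * (c - h t)"] lo(2) by simp
  moreover have "a \<in> {lo..hi}" using e(1) by (auto simp: lo_def hi_def)
  ultimately have "\<rho> a = 0" using c by auto
  moreover have "\<not> \<bar>a - b\<bar> < e" using e(5)[of a] c(1) by force
  ultimately show False using bump_pos[of 0 e] e(1) by (simp add: \<rho>_def bump_zero)
qed

text \<open>Subtract a classical antiderivative of \<open>g\<close>: the difference has zero weak
  derivative and is therefore constant, by the preceding lemma applied in both directions.\<close>

lemma weak_deriv_imp_classical:
  assumes h: "continuous_on {0<..} h" and g: "continuous_on {0<..} g"
    and w: "\<And>\<phi>. test_function \<phi> \<Longrightarrow>
      (LINT t|lebesgue_on {0<..}. deriv \<phi> t * h t) = - (LINT t|lebesgue_on {0<..}. \<phi> t * g t)"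
    and "t > 0"
  shows "(h has_real_derivative g t) (at t)"
proof -
  have "\<exists>G. \<forall>x. (0 :: ereal) < x \<longrightarrow> x < (\<infinity> :: ereal) \<longrightarrow> (G has_vector_derivative g x) (at x)"
    by (rule einterval_antiderivative)
      (use g in \<open>auto simp: continuous_on_eq_continuous_at\<close>)
  then obtain G where G: "\<And>x. x > 0 \<Longrightarrow> (G has_real_derivative g x) (at x)"
    by (auto simp: has_real_derivative_iff_has_vector_derivative)
  have cG: "continuous_on {0<..} G"
    by (metis DERIV_isCont continuous_at_imp_continuous_on greaterThan_iff G)
  have z: "(LINT t|lebesgue_on {0<..}. deriv \<phi> t * (h t - G t)) = 0" if "test_function \<phi>" for \<phi>
  proof -
    have "(LINT t|lebesgue_on {0<..}. deriv \<phi> t * (h t - G t)) =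
        (LINT t|lebesgue_on {0<..}. deriv \<phi> t * h t) - (LINT t|lebesgue_on {0<..}. deriv \<phi> t * G t)"
      unfolding right_diff_distrib
      by (intro Bochner_Integration.integral_diff integrable_test_mult(2)[OF that] h cG)
    then show ?thesis using w[OF that] weak_deriv_classical[OF that G g] by simp
  qed
  have eq: "h x - G x = h t - G t" if "x > 0" for x
    using weak_deriv_zero_not_less[OF continuous_on_diff[OF h cG] z that \<open>t > 0\<close>]
      weak_deriv_zero_not_less[OF continuous_on_diff[OF h cG] z \<open>t > 0\<close> that] by linarith
  have "((\<lambda>x. G x + (h t - G t)) has_real_derivative g t) (at t)"
    using DERIV_add[OF G[OF \<open>t > 0\<close>] DERIV_const] by simp
  then show ?thesis
    by (rule has_field_derivative_transform_within_open[of _ _ _ "{0<..}"])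
      (use \<open>t > 0\<close> in \<open>simp_all add: eq[symmetric]\<close>)
qed

section \<open>Operators and weak derivatives in \<open>H\<^sup>s\<close>\<close>

lemma bounded_linear_coord: "bounded_linear (\<lambda>x. coord x j)"
  by (rule bounded_linear_intro[where K = 1])
    (simp_all add: plus_ell2.rep_eq scaleR_ell2.rep_eq abs_coord_le)

lemma ell2_eqI: "(\<And>j. coord x j = coord y j) \<Longrightarrow> x = y"
  by (simp add: coord_inject[symmetric] fun_eq_iff)

lemma norm_ell2_le:
  assumes "\<And>F. finite F \<Longrightarrow> (\<Sum>j\<in>F. (coord x j)\<^sup>2) \<le> B"
  shows "(norm x)\<^sup>2 \<le> B"
  unfolding norm_ell2_square by (rule infsum_le_finite_sums[OF coord_square_summable]) (rule assms)

text \<open>Finite truncations are continuous, and their errors are bounded by the tail of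
  \<open>g\<close> uniformly in \<open>t\<close>; a uniform limit of continuous functions is
  continuous.\<close>

lemma continuous_on_ell2_dominated:
  fixes u :: "'a::metric_space \<Rightarrow> 'i ell2"
  assumes cont: "\<And>j. continuous_on S (\<lambda>t. coord (u t) j)"
    and dom: "\<And>t j. t \<in> S \<Longrightarrow> \<bar>coord (u t) j\<bar> \<le> \<bar>coord g j\<bar>"
  shows "continuous_on S u"
proof -
  define e :: "'i \<Rightarrow> 'i ell2" where "e j = Abs_ell2 (\<lambda>i. if i = j then 1 else 0)" for j
  have "(\<lambda>i. (if i = j then 1 else 0 :: real)\<^sup>2) summable_on UNIV" for j :: 'i
    by (rule summable_on_cong_neutral[THEN iffD1, OF _ _ _ summable_on_finite[of "{j}"]]) auto
  then have e: "coord (e j) i = (if i = j then 1 else 0)" for i j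
    by (simp add: e_def Abs_ell2_inverse)
  define v where "v = (\<lambda>F t. \<Sum>j\<in>F. coord (u t) j *\<^sub>R e j)"
  have cv: "coord (v F t) i = (if i \<in> F then coord (u t) i else 0)" if "finite F" for F t i
  proof -
    have "coord (v F t) i = (\<Sum>j\<in>F. coord (coord (u t) j *\<^sub>R e j) i)"
      unfolding v_def by (rule linear_sum[OF bounded_linear.linear[OF bounded_linear_coord]])
    also have "\<dots> = (\<Sum>j\<in>F. if i = j then coord (u t) j else 0)"
      by (rule sum.cong) (auto simp: scaleR_ell2.rep_eq e)
    finally show ?thesis using that by simp
  qed
  have bound: "(norm (v F t - u t))\<^sup>2 \<le> (norm g)\<^sup>2 - (\<Sum>j\<in>F. (coord g j)\<^sup>2)" if F: "finite F" and t: "t \<in> S" for F t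
  proof (rule norm_ell2_le)
    fix F' :: "'i set" assume F': "finite F'"
    have "(\<Sum>j\<in>F'. (coord (v F t - u t) j)\<^sup>2) = (\<Sum>j\<in>F'. if j \<in> F then 0 else (coord (u t) j)\<^sup>2)"
      by (rule sum.cong) (auto simp: minus_ell2.rep_eq cv[OF F])
    also have "\<dots> = (\<Sum>j\<in>F' - F. (coord (u t) j)\<^sup>2)"
      by (rule sum.mono_neutral_cong_right) (use F' in auto)
    also have "\<dots> \<le> (\<Sum>j\<in>F' - F. (coord g j)\<^sup>2)"
      by (rule sum_mono) (use dom[OF t] in \<open>simp add: abs_le_square_iff\<close>)
    also have "\<dots> = (\<Sum>j\<in>F' \<union> F. (coord g j)\<^sup>2) - (\<Sum>j\<in>F. (coord g j)\<^sup>2)"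
      using sum_diff[of "F' \<union> F" F "\<lambda>j. (coord g j)\<^sup>2"] F F' by (simp add: Un_Diff)
    also have "\<dots> \<le> (norm g)\<^sup>2 - (\<Sum>j\<in>F. (coord g j)\<^sup>2)"
      using finite_sum_coord_le[of "F' \<union> F" g] F F' by simp
    finally show "(\<Sum>j\<in>F'. (coord (v F t - u t) j)\<^sup>2) \<le> (norm g)\<^sup>2 - (\<Sum>j\<in>F. (coord g j)\<^sup>2)" .
  qed
  show ?thesis
  proof (rule uniform_limit_theorem)
    show "\<forall>\<^sub>F F in finite_subsets_at_top UNIV. continuous_on S (v F)"
      unfolding v_def by (intro always_eventually allI continuous_intros cont)
    show "uniform_limit S v u (finite_subsets_at_top UNIV)"
    proof (rule uniform_limitI)
      fix \<epsilon> :: real assume "\<epsilon> > 0"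
      have "(sum (\<lambda>i. (coord g i)\<^sup>2) \<longlongrightarrow> (norm g)\<^sup>2) (finite_subsets_at_top UNIV)"
        using has_sum_infsum[OF coord_square_summable[of g]] unfolding has_sum_def norm_ell2_square .
      moreover have "(norm g)\<^sup>2 - \<epsilon>\<^sup>2 < (norm g)\<^sup>2" using \<open>\<epsilon> > 0\<close> by simp
      ultimately have "\<forall>\<^sub>F F in finite_subsets_at_top UNIV. (norm g)\<^sup>2 - \<epsilon>\<^sup>2 < (\<Sum>i\<in>F. (coord g i)\<^sup>2)"
        by (rule order_tendstoD)
      moreover have "\<forall>\<^sub>F F in finite_subsets_at_top (UNIV :: 'i set). finite F"
        by (auto simp: eventually_finite_subsets_at_top)
      ultimately show "\<forall>\<^sub>F F in finite_subsets_at_top UNIV. \<forall>t\<in>S. dist (v F t) (u t) < \<epsilon>"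
      proof eventually_elim
        case (elim F)
        show ?case
        proof
          fix t assume "t \<in> S"
          then have "(norm (v F t - u t))\<^sup>2 < \<epsilon>\<^sup>2" using bound[OF elim(2)] elim(1) by fastforce
          then show "dist (v F t) (u t) < \<epsilon>"
            using power2_less_imp_less[of "norm (v F t - u t)" \<epsilon>] \<open>\<epsilon> > 0\<close> by (simp add: dist_norm)
        qed
      qed
    qed
  qed simp
qed

section \<open>Membership in the weighted spaces and operators on them\<close>

lemma H_iff: "f \<in> H s \<longleftrightarrow> (\<lambda>j. (wt s j * f j)\<^sup>2) summable_on UNIV"
  using weighted_square_summable by blast

lemma H_le:
  assumes "f \<in> H s" "\<And>j. \<bar>wt s' j * g j\<bar> \<le> B * \<bar>wt s j * f j\<bar>"
  shows "g \<in> H s'"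
proof -
  have "(\<lambda>j. (B * (wt s j * f j))\<^sup>2) summable_on UNIV"
    using assms(1) by (intro square_summable_scale) (simp add: H_iff)
  then have "(\<lambda>j. (wt s' j * g j)\<^sup>2) summable_on UNIV"
  proof (rule summable_on_comparison_test)
    fix j
    have "\<bar>wt s' j * g j\<bar> \<le> \<bar>B * (wt s j * f j)\<bar>"
      using assms(2)[of j] mult_right_mono[OF abs_ge_self[of B] abs_ge_zero[of "wt s j * f j"]]
      unfolding abs_mult[of B] by linarith
    then show "(wt s' j * g j)\<^sup>2 \<le> (B * (wt s j * f j))\<^sup>2" by (simp only: abs_le_square_iff)
  qed simp
  then show ?thesis by (simp add: H_iff)
qed

lemma H_mono: "f \<in> H s \<Longrightarrow> s' \<le> s \<Longrightarrow> f \<in> H s'"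
  by (rule H_le[where B = 1]) (auto simp: abs_mult intro!: mult_right_mono wt_mono)

lemma H_add: "f \<in> H s \<Longrightarrow> g \<in> H s \<Longrightarrow> (\<lambda>j. f j + g j) \<in> H s"
  unfolding H_iff using square_summable_add[of "\<lambda>j. wt s j * f j" "\<lambda>j. wt s j * g j"]
  by (simp add: distrib_left)

lemma H_scale: "f \<in> H s \<Longrightarrow> (\<lambda>j. r * f j) \<in> H s"
  unfolding H_iff using square_summable_scale[of "\<lambda>j. wt s j * f j" r]
  by (simp add: mult.left_commute)

lemma emb_add: "f \<in> H s \<Longrightarrow> g \<in> H s \<Longrightarrow> emb s (\<lambda>j. f j + g j) = emb s f + emb s g"
  by (rule ell2_eqI) (simp add: coord_emb H_add plus_ell2.rep_eq distrib_left)

lemma emb_scale: "f \<in> H s \<Longrightarrow> emb s (\<lambda>j. r * f j) = r *\<^sub>R emb s f"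
  by (rule ell2_eqI) (simp add: coord_emb H_scale scaleR_ell2.rep_eq mult.left_commute)

lemma H_zero: "(\<lambda>j. 0) \<in> H s"
  by (simp add: H_iff)

lemma H_sum_emb:
  assumes "finite F" "\<And>p. p \<in> F \<Longrightarrow> f p \<in> H s"
  shows "(\<lambda>j. \<Sum>p\<in>F. f p j) \<in> H s \<and> emb s (\<lambda>j. \<Sum>p\<in>F. f p j) = (\<Sum>p\<in>F. emb s (f p))"
  using assms
proof (induction F)
  case empty
  have "emb s (\<lambda>j. 0) = 0" by (rule ell2_eqI) (simp add: coord_emb H_zero zero_ell2.rep_eq)
  then show ?case by (simp add: H_zero)
qed (simp add: H_add emb_add)

lemma abs_coeff_le: "f \<in> H s \<Longrightarrow> \<bar>f j\<bar> \<le> hnorm s f / wt s j"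
  using abs_coord_le[of "emb s f" j] by (simp add: coord_emb norm_emb abs_mult pos_le_divide_eq mult.commute)

lemma hnorm_nonneg: "f \<in> H s \<Longrightarrow> hnorm s f \<ge> 0"
  by (metis norm_emb norm_ge_zero)

text \<open>The condition says 2(s + a) < -1, the convergence of the sum of n^(2(s + a)). For a = -m
  - 2 it becomes s < m + 3/2.\<close>

lemma dominated_imp_H:
  assumes "dominated a g" "s + a < - 1/2"
  shows "g \<in> H s"
proof -
  obtain B where B: "B \<ge> 0" "\<And>j. \<bar>g j\<bar> \<le> B * wt a j" using dominated_nonneg[OF assms(1)] by blast
  have "summable (\<lambda>n. real n powr (2 * (s + a)))"
    using assms(2) by (simp add: summable_real_powr_iff)
  then have "summable (\<lambda>n. 2 * B\<^sup>2 * real (Suc n) powr (2 * (s + a)))"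
    by (intro summable_mult) (subst summable_Suc_iff)
  then show ?thesis
    unfolding H_def mem_Collect_eq
  proof (rule summable_comparison_test'[where N = 0])
    fix n :: nat
    have sq: "(g j)\<^sup>2 \<le> B\<^sup>2 * (wt a j)\<^sup>2" for j
      using B(2)[of j] abs_le_square_iff[of "g j" "B * wt a j"] B(1)
      by (simp add: power_mult_distrib abs_mult less_imp_le)
    have w: "wt a (- int (Suc n)) = real (Suc n) powr a" "wt a (int (Suc n)) = real (Suc n) powr a"
      by (simp_all add: wt_def abs_if add.commute)
    have "(g (- int (Suc n)))\<^sup>2 + (g (int (Suc n)))\<^sup>2 \<le> 2 * B\<^sup>2 * (real (Suc n) powr a)\<^sup>2"
      using sq[of "- int (Suc n)"] sq[of "int (Suc n)"] unfolding w by simp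
    then have "real (Suc n) powr (2 * s) * ((g (- int (Suc n)))\<^sup>2 + (g (int (Suc n)))\<^sup>2)
        \<le> real (Suc n) powr (2 * s) * (2 * B\<^sup>2 * (real (Suc n) powr a)\<^sup>2)"
      by (intro mult_left_mono) auto
    also have "\<dots> = 2 * B\<^sup>2 * real (Suc n) powr (2 * (s + a))"
      by (simp add: powr_power powr_add[symmetric] distrib_left mult.commute mult.left_commute add.commute del: of_nat_Suc)
    finally show "norm (real (Suc n) powr (2 * s) * ((g (- int (Suc n)))\<^sup>2 + (g (int (Suc n)))\<^sup>2))
        \<le> 2 * B\<^sup>2 * real (Suc n) powr (2 * (s + a))" by simp
  qed
qed

text \<open>Writing the image with scalar coefficients in front of fixed vectors reduces
  boundedness, and continuity in time, to the coefficients \<open>x p\<close> with \<open>p\<close>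
  in \<open>F\<close>.\<close>

lemma fin_rank_H:
  assumes F: "finite F" and c: "\<forall>p\<in>F. dominated a (\<lambda>j. c j p)" and s: "s + a < - 1/2" and x: "x \<in> H s"
  shows "fin_rank F c x \<in> H s"
    and "emb s (fin_rank F c x) = emb s x + (\<Sum>p\<in>F. x p *\<^sub>R emb s (\<lambda>j. c j p))"
proof -
  have cH: "(\<lambda>j. c j p) \<in> H s" if "p \<in> F" for p using c that s by (intro dominated_imp_H) auto
  have eq: "fin_rank F c x = (\<lambda>j. x j + (\<Sum>p\<in>F. x p * c j p))"
    by (simp add: fin_rank_def fun_eq_iff mult.commute)
  have S: "(\<lambda>j. \<Sum>p\<in>F. x p * c j p) \<in> H s \<and> emb s (\<lambda>j. \<Sum>p\<in>F. x p * c j p) = (\<Sum>p\<in>F. emb s (\<lambda>j. x p * c j p))"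
    by (rule H_sum_emb[OF F]) (intro H_scale cH)
  show "fin_rank F c x \<in> H s" unfolding eq using S x by (intro H_add) auto
  show "emb s (fin_rank F c x) = emb s x + (\<Sum>p\<in>F. x p *\<^sub>R emb s (\<lambda>j. c j p))"
    unfolding eq using S x cH by (simp add: emb_add emb_scale)
qed

lemma fin_rank_bounded:
  assumes F: "finite F" and c: "\<forall>p\<in>F. dominated a (\<lambda>j. c j p)" and s: "s + a < - 1/2"
  shows "\<exists>B\<ge>0. \<forall>x\<in>H s. hnorm s (fin_rank F c x) \<le> B * hnorm s x"
proof -
  define B where "B = 1 + (\<Sum>p\<in>F. 1 / wt s p * norm (emb s (\<lambda>j. c j p)))"
  have "B \<ge> 0" unfolding B_def by (intro add_nonneg_nonneg sum_nonneg mult_nonneg_nonneg) (simp_all add: less_imp_le)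
  moreover have "hnorm s (fin_rank F c x) \<le> B * hnorm s x" if x: "x \<in> H s" for x
  proof -
    have "hnorm s (fin_rank F c x) = norm (emb s x + (\<Sum>p\<in>F. x p *\<^sub>R emb s (\<lambda>j. c j p)))"
      using fin_rank_H[OF F c s x] by (metis norm_emb)
    also have "\<dots> \<le> norm (emb s x) + (\<Sum>p\<in>F. norm (x p *\<^sub>R emb s (\<lambda>j. c j p)))"
      by (intro norm_triangle_le add_left_mono norm_sum)
    also have "\<dots> \<le> norm (emb s x) + (\<Sum>p\<in>F. (hnorm s x / wt s p) * norm (emb s (\<lambda>j. c j p)))"
      unfolding norm_scaleR using abs_coeff_le[OF x] by (intro add_left_mono sum_mono mult_right_mono) auto
    also have "\<dots> = B * hnorm s x"
      by (simp add: B_def norm_emb[OF x] distrib_right sum_distrib_right) (simp add: mult.commute)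
    finally show ?thesis .
  qed
  ultimately show ?thesis by blast
qed

lemma continuous_coeff:
  assumes "\<And>t. t \<in> S \<Longrightarrow> u t \<in> H s" "continuous_on S (\<lambda>t. emb s (u t))"
  shows "continuous_on S (\<lambda>t. u t p)"
proof -
  have "continuous_on S (\<lambda>t. coord (emb s (u t)) p / wt s p)"
    by (intro continuous_intros bounded_linear.continuous_on[OF bounded_linear_coord] assms) simp
  moreover have "coord (emb s (u t)) p / wt s p = u t p" if "t \<in> S" for t
    using assms(1)[OF that] by (simp add: coord_emb)
  ultimately show ?thesis by (simp cong: continuous_on_cong)
qed

lemma continuous_fin_rank:
  assumes F: "finite F" and c: "\<forall>p\<in>F. dominated a (\<lambda>j. c j p)" and s: "s + a < - 1/2"
    and u: "\<And>t. t \<in> S \<Longrightarrow> u t \<in> H s" and cu: "continuous_on S (\<lambda>t. emb s (u t))"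
  shows "continuous_on S (\<lambda>t. emb s (fin_rank F c (u t)))"
proof -
  have "continuous_on S (\<lambda>t. emb s (u t) + (\<Sum>p\<in>F. u t p *\<^sub>R emb s (\<lambda>j. c j p)))"
    by (intro continuous_intros cu continuous_coeff[OF u cu])
  then show ?thesis using fin_rank_H(2)[OF F c s u] by (simp cong: continuous_on_cong)
qed

lemma continuous_imp_L2loc:
  assumes u: "\<And>t. t > 0 \<Longrightarrow> u t \<in> H s" and cu: "continuous_on {0<..} (\<lambda>t. emb s (u t))"
  shows "u \<in> L2loc_H s"
  unfolding L2loc_H_def mem_Collect_eq
proof (intro conjI allI impI)
  have "AE t in lebesgue_on {0<..}. t \<in> space (lebesgue_on {0 :: real<..})"
    by (rule AE_space)
  then show "AE t in lebesgue_on {0<..}. u t \<in> H s" by eventually_elim (use u in simp)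
  show "(\<lambda>t. emb s (u t)) \<in> borel_measurable (lebesgue_on {0<..})"
    by (rule continuous_imp_measurable_on_sets_lebesgue[OF cu]) simp
  fix J :: "real set" assume J: "compact J" "J \<subseteq> {0<..}"
  have "continuous_on J (\<lambda>t. (norm (emb s (u t)))\<^sup>2)"
    by (intro continuous_intros continuous_on_subset[OF cu J(2)])
  then have i: "integrable lborel (\<lambda>t. indicator J t *\<^sub>R (norm (emb s (u t)))\<^sup>2)"
    by (rule borel_integrable_compact[OF J(1)])
  have "J \<in> sets lebesgue" using J(1) by (simp add: borel_compact)
  then show "integrable (lebesgue_on J) (\<lambda>t. (norm (emb s (u t)))\<^sup>2)"
    using i by (subst integrable_restrict_space) (auto simp: integrable_completion)
qed

text \<open>On a bounded interval square integrability is enough, since the norm is at most 1 plus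
  its square. Integrability is what allows coordinates to be taken under the vector-valued
  integral.\<close>

lemma integrable_test_emb:
  assumes u: "u \<in> L2loc_H s" and \<psi>: "continuous_on UNIV \<psi>" "0 < a" "\<And>t. t \<notin> {a..b} \<Longrightarrow> \<psi> t = 0"
  shows "integrable (lebesgue_on {0<..}) (\<lambda>t. \<psi> t *\<^sub>R emb s (u t))"
proof -
  have "bounded (\<psi> ` {a..b})"
    by (intro compact_imp_bounded compact_continuous_image continuous_on_subset[OF \<psi>(1)]) auto
  then obtain M where M: "\<And>t. t \<in> {a..b} \<Longrightarrow> \<bar>\<psi> t\<bar> \<le> M"
    unfolding bounded_iff real_norm_def by blast
  have meas: "(\<lambda>t. emb s (u t)) \<in> borel_measurable (lebesgue_on {0<..})"
    and I: "integrable (lebesgue_on {a..b}) (\<lambda>t. (norm (emb s (u t)))\<^sup>2)"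
    using u \<psi>(2) unfolding L2loc_H_def by (auto dest: spec[of _ "{a..b}"])
  have "integrable (lebesgue_on {a..b}) (\<lambda>t. M * (1 + (norm (emb s (u t)))\<^sup>2))"
    using I by (intro integrable_mult_right Bochner_Integration.integrable_add)
      (simp_all add: integrable_restrict_space)
  then have "integrable lebesgue (\<lambda>t. indicator {a..b} t *\<^sub>R (M * (1 + (norm (emb s (u t)))\<^sup>2)))"
    by (subst (asm) integrable_restrict_space) auto
  moreover have "(\<lambda>t. indicator {a..b} t *\<^sub>R (M * (1 + (norm (emb s (u t)))\<^sup>2))) =
      (\<lambda>t. indicator {0<..} t *\<^sub>R (indicator {a..b} t *\<^sub>R (M * (1 + (norm (emb s (u t)))\<^sup>2))))"
    using \<psi>(2) by (auto simp: indicator_def fun_eq_iff)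
  ultimately have "integrable (lebesgue_on {0<..}) (\<lambda>t. indicator {a..b} t *\<^sub>R (M * (1 + (norm (emb s (u t)))\<^sup>2)))"
    by (subst integrable_restrict_space) auto
  then show ?thesis
  proof (rule Bochner_Integration.integrable_bound)
    have "\<psi> \<in> borel_measurable (lebesgue_on {0<..})"
      by (rule continuous_imp_measurable_on_sets_lebesgue[OF continuous_on_subset[OF \<psi>(1)]]) auto
    then show "(\<lambda>t. \<psi> t *\<^sub>R emb s (u t)) \<in> borel_measurable (lebesgue_on {0<..})"
      using meas by (rule borel_measurable_scaleR)
    have "norm (\<psi> t *\<^sub>R emb s (u t)) \<le> norm (indicator {a..b} t *\<^sub>R (M * (1 + (norm (emb s (u t)))\<^sup>2)))" for t
    proof (cases "t \<in> {a..b}")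
      case True
      have "0 \<le> M" using M[OF True] by linarith
      have "norm (emb s (u t)) \<le> 1 + (norm (emb s (u t)))\<^sup>2"
        using zero_le_power2[of "norm (emb s (u t)) - 1"] norm_ge_zero[of "emb s (u t)"]
        unfolding power2_diff power_one mult_1_right by linarith
      then have "\<bar>\<psi> t\<bar> * norm (emb s (u t)) \<le> M * (1 + (norm (emb s (u t)))\<^sup>2)"
        using M[OF True] \<open>0 \<le> M\<close> by (intro mult_mono) auto
      then show ?thesis using True \<open>0 \<le> M\<close> by (simp add: abs_mult)
    qed (simp add: \<psi>(3))
    then show "AE t in lebesgue_on {0<..}. norm (\<psi> t *\<^sub>R emb s (u t)) \<le> norm (indicator {a..b} t *\<^sub>R (M * (1 + (norm (emb s (u t)))\<^sup>2)))"
      by simp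
  qed
qed

text \<open>Coordinates are bounded functionals, so they commute with the integrals, and together
  they determine a vector. All further work on weak derivatives is therefore scalar.\<close>

lemma weak_deriv_coord:
  assumes u: "u \<in> L2loc_H s" and v: "v \<in> L2loc_H s"
  shows "weak_deriv s u v \<longleftrightarrow> (\<forall>\<phi> j. test_function \<phi> \<longrightarrow>
    (LINT t|lebesgue_on {0<..}. deriv \<phi> t * coord (emb s (u t)) j) =
    - (LINT t|lebesgue_on {0<..}. \<phi> t * coord (emb s (v t)) j))"
proof -
  have eq: "coord (LINT t|lebesgue_on {0<..}. deriv \<phi> t *\<^sub>R emb s (u t)) j =
        (LINT t|lebesgue_on {0<..}. deriv \<phi> t * coord (emb s (u t)) j)"
      "coord (LINT t|lebesgue_on {0<..}. \<phi> t *\<^sub>R emb s (v t)) j =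
        (LINT t|lebesgue_on {0<..}. \<phi> t * coord (emb s (v t)) j)" if \<phi>: "test_function \<phi>" for \<phi> j
  proof -
    obtain a b where ab: "0 < a" "\<forall>t. t \<notin> {a<..<b} \<longrightarrow> \<phi> t = 0 \<and> deriv \<phi> t = 0"
      using test_function_support[OF \<phi>] by blast
    have z: "\<phi> t = 0" "deriv \<phi> t = 0" if "t \<notin> {a..b}" for t
      using ab(2) that by auto
    have "integrable (lebesgue_on {0<..}) (\<lambda>t. deriv \<phi> t *\<^sub>R emb s (u t))"
      by (rule integrable_test_emb[OF u test_function_continuous_deriv[OF \<phi>] ab(1) z(2)])
    from integral_bounded_linear[OF bounded_linear_coord this, of j]
    show "coord (LINT t|lebesgue_on {0<..}. deriv \<phi> t *\<^sub>R emb s (u t)) j =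
        (LINT t|lebesgue_on {0<..}. deriv \<phi> t * coord (emb s (u t)) j)"
      by (simp add: scaleR_ell2.rep_eq)
    have "integrable (lebesgue_on {0<..}) (\<lambda>t. \<phi> t *\<^sub>R emb s (v t))"
      by (rule integrable_test_emb[OF v test_function_continuous[OF \<phi>] ab(1) z(1)])
    from integral_bounded_linear[OF bounded_linear_coord this, of j]
    show "coord (LINT t|lebesgue_on {0<..}. \<phi> t *\<^sub>R emb s (v t)) j =
        (LINT t|lebesgue_on {0<..}. \<phi> t * coord (emb s (v t)) j)"
      by (simp add: scaleR_ell2.rep_eq)
  qed
  show ?thesis
    unfolding weak_deriv_def coord_inject[symmetric] fun_eq_iff uminus_ell2.rep_eq
    using eq by (metis (no_types, lifting))
qed

section \<open>The closed loop\<close>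

lemma hnorm_le:
  assumes f: "f \<in> H s" and g: "\<And>j. \<bar>wt s' j * g j\<bar> \<le> B * \<bar>wt s j * f j\<bar>" and "B \<ge> 0"
  shows "hnorm s' g \<le> B * hnorm s f"
proof -
  have gH: "g \<in> H s'" by (rule H_le[OF f g])
  have "(norm (emb s' g))\<^sup>2 \<le> B\<^sup>2 * (norm (emb s f))\<^sup>2"
  proof (rule norm_ell2_le)
    fix E :: "int set" assume E: "finite E"
    have "(\<Sum>j\<in>E. (coord (emb s' g) j)\<^sup>2) \<le> (\<Sum>j\<in>E. B\<^sup>2 * (coord (emb s f) j)\<^sup>2)"
    proof (rule sum_mono)
      fix j
      have "\<bar>wt s' j * g j\<bar> \<le> \<bar>B * (wt s j * f j)\<bar>" using g[of j] \<open>B \<ge> 0\<close> by (simp add: abs_mult)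
      then have "(wt s' j * g j)\<^sup>2 \<le> (B * (wt s j * f j))\<^sup>2" by (simp only: abs_le_square_iff)
      then show "(coord (emb s' g) j)\<^sup>2 \<le> B\<^sup>2 * (coord (emb s f) j)\<^sup>2"
        by (simp only: coord_emb[OF gH] coord_emb[OF f] power_mult_distrib)
    qed
    also have "\<dots> \<le> B\<^sup>2 * (norm (emb s f))\<^sup>2"
      unfolding sum_distrib_left[symmetric] by (intro mult_left_mono finite_sum_coord_le E) simp
    finally show "(\<Sum>j\<in>E. (coord (emb s' g) j)\<^sup>2) \<le> B\<^sup>2 * (norm (emb s f))\<^sup>2" .
  qed
  then have "(hnorm s' g)\<^sup>2 \<le> (B * hnorm s f)\<^sup>2" by (simp add: norm_emb gH f power_mult_distrib)
  then show ?thesis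
    by (rule power2_le_imp_le) (use \<open>B \<ge> 0\<close> hnorm_nonneg[OF f] in simp)
qed

text \<open>A Fourier multiplier of order \<open>s - s'\<close> costs that many derivatives; a
  negative order gains them.\<close>

lemma dominated_mult_H:
  assumes "dominated (s - s') q" "f \<in> H s"
  shows "(\<lambda>j. q j * f j) \<in> H s'"
proof -
  obtain B where B: "B \<ge> 0" "\<And>j. \<bar>q j\<bar> \<le> B * wt (s - s') j" using dominated_nonneg[OF assms(1)] by blast
  show ?thesis
  proof (rule H_le[OF assms(2)])
    fix j
    have "wt s' j * \<bar>q j\<bar> * \<bar>f j\<bar> \<le> wt s' j * (B * wt (s - s') j) * \<bar>f j\<bar>"
      by (intro mult_right_mono mult_left_mono B) (simp_all add: less_imp_le)
    also have "\<dots> = B * (wt (s' + (s - s')) j * \<bar>f j\<bar>)" by (simp only: wt_mult[symmetric] mult_ac)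
    finally show "\<bar>wt s' j * (q j * f j)\<bar> \<le> B * \<bar>wt s j * f j\<bar>" by (simp add: abs_mult mult.assoc)
  qed
qed

section \<open>Smoothing and decay of the diagonal semigroup\<close>

lemma dominated_exp:
  assumes F: "finite F" and M: "\<forall>j. j \<notin> F \<longrightarrow> M j = (of_int j)\<^sup>2" and t: "t > 0"
  shows "dominated a (\<lambda>j. exp (- M j * t))"
proof -
  \<comment> \<open>The bound (1 + y/n)^n <= exp y with y = t * j^2 yields decay of order 2 * n in
    j. Rounding up |a| makes this order sufficient, and the added 1 permits division by
    \<open>n\<close>.\<close>
  define n where "n = nat \<lceil>\<bar>a\<bar>\<rceil> + 1"
  have n: "n > 0" "- 2 * real n \<le> a" unfolding n_def by (simp_all, linarith)
  have "dominated (- 2 * real n) (\<lambda>j. exp (- M j * t))"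
  proof (rule dominated_cofinite)
    show "finite (F \<union> {0})" using F by simp
    fix j assume j: "j \<notin> F \<union> {0}"
    define x where "x = (real_of_int j)\<^sup>2"
    have x: "x > 0" using j by (simp add: x_def)
    have "(t * x / n) ^ n \<le> (1 + t * x / n) ^ n" using x t n by (intro power_mono) auto
    also have "\<dots> \<le> exp (t * x)"
      using mult_pos_pos[OF t x] n by (intro exp_ge_one_plus_x_over_n_power_n) linarith+
    finally have "(t * x / n) ^ n \<le> exp (t * x)" .
    moreover have "(t * x / n) ^ n > 0" using x t n by simp
    ultimately have "exp (- (t * x)) \<le> 1 / (t * x / n) ^ n"
      unfolding exp_minus inverse_eq_divide by (intro divide_left_mono) auto
    also have "\<dots> = (n / t) ^ n * (1 / x ^ n)" by (simp add: power_divide power_mult_distrib)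
    also have "1 / x ^ n = wt (- 2 * real n) j"
    proof -
      have "\<bar>real_of_int j\<bar> powr (real (2 * n)) = \<bar>real_of_int j\<bar> ^ (2 * n)"
        using j by (intro powr_realpow) auto
      then show ?thesis using j
        by (simp add: wt_def powr_minus_divide x_def power_mult[symmetric] power_even_abs)
    qed
    finally show "\<bar>exp (- M j * t)\<bar> \<le> (n / t) ^ n * wt (- 2 * real n) j"
      using j by (simp add: M x_def mult.commute)
  qed
  then show ?thesis using n(2) by (rule dominated_mono)
qed

text \<open>The factor \<open>q\<close> allows both the semigroup (\<open>q = 1\<close>) and its time derivative (\<open>q = - M\<close>).\<close>

lemma semigroup_smoothing:
  assumes F: "finite F" and M: "\<forall>j. j \<notin> F \<longrightarrow> M j = (of_int j)\<^sup>2" and M0: "\<And>j. M j \<ge> 0"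
    and z: "z \<in> H \<sigma>" and q: "dominated b q"
  shows "t > 0 \<Longrightarrow> (\<lambda>j. q j * (exp (- M j * t) * z j)) \<in> H s" (is "_ \<Longrightarrow> ?u t \<in> H s")
    and "continuous_on {0<..} (\<lambda>t. emb s (\<lambda>j. q j * (exp (- M j * t) * z j)))"
proof -
  have u: "?u t \<in> H s" if "t > 0" for t
  proof -
    \<comment> \<open>The exponential has every order, so its order is chosen to compensate both
      \<open>q\<close> and the difference between \<open>\<sigma>\<close> and
      \<open>s\<close>.\<close>
    have "dominated (b + (\<sigma> - s - b)) (\<lambda>j. q j * exp (- M j * t))"
      by (rule dominated_mult[OF q dominated_exp[OF F M that]])
    then have "(\<lambda>j. q j * exp (- M j * t) * z j) \<in> H s"
      by (intro dominated_mult_H[OF _ z]) simp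
    then show ?thesis by (simp add: mult.assoc)
  qed
  then show "t > 0 \<Longrightarrow> ?u t \<in> H s" .
  \<comment> \<open>Since \<open>M\<close> is nonnegative, the coefficients decrease in modulus, and
    those at time \<open>a\<close> dominate all later ones. At time 0 they need not lie in
    \<open>H s\<close>, so the argument runs on (a, infinity) and then lets \<open>a\<close>
    vary.\<close>
  have *: "continuous_on {a<..} (\<lambda>t. emb s (?u t))" if a: "a > 0" for a
  proof (rule continuous_on_ell2_dominated)
    fix j
    have "continuous_on {a<..} (\<lambda>t. wt s j * (q j * (exp (- M j * t) * z j)))"
      by (intro continuous_intros)
    then show "continuous_on {a<..} (\<lambda>t. coord (emb s (?u t)) j)"
      by (rule continuous_on_eq) (subst coord_emb[OF u], use a in simp_all)
  next
    fix t j assume t: "t \<in> {a<..}"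
    have "exp (- M j * t) \<le> exp (- M j * a)"
      using t M0[of j] by (simp add: mult_left_mono)
    then have "wt s j * \<bar>q j\<bar> * exp (- M j * t) * \<bar>z j\<bar> \<le> wt s j * \<bar>q j\<bar> * exp (- M j * a) * \<bar>z j\<bar>"
      by (intro mult_right_mono mult_left_mono mult_nonneg_nonneg) (simp_all add: less_imp_le)
    then show "\<bar>coord (emb s (?u t)) j\<bar> \<le> \<bar>coord (emb s (?u a)) j\<bar>"
      unfolding coord_emb[OF u[OF a]] coord_emb[OF u[OF less_trans[OF a t[unfolded greaterThan_iff]]]]
      by (simp add: abs_mult mult.assoc)
  qed
  have "isCont (\<lambda>t. emb s (?u t)) t" if "t > 0" for t
  proof -
    have "continuous_on {t / 2<..} (\<lambda>t. emb s (?u t))" using that by (intro *) simp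
    then show ?thesis using that by (simp add: continuous_on_eq_continuous_at)
  qed
  then show "continuous_on {0<..} (\<lambda>t. emb s (?u t))"
    by (intro continuous_at_imp_continuous_on) simp
qed

text \<open>In the space of the initial value, \<open>z\<close> itself is a majorant, which gives
  continuity down to time 0.\<close>

lemma semigroup_decay:
  assumes M: "\<And>j. M j \<ge> \<Lambda>" and \<Lambda>: "\<Lambda> > 0" and z: "z \<in> H \<sigma>"
  shows "t \<ge> 0 \<Longrightarrow> (\<lambda>j. exp (- M j * t) * z j) \<in> H \<sigma>" (is "_ \<Longrightarrow> ?u t \<in> H \<sigma>")
    and "t \<ge> 0 \<Longrightarrow> hnorm \<sigma> (\<lambda>j. exp (- M j * t) * z j) \<le> exp (- \<Lambda> * t) * hnorm \<sigma> z"
    and "continuous_on {0..} (\<lambda>t. emb \<sigma> (\<lambda>j. exp (- M j * t) * z j))"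
proof -
  have le: "\<bar>wt \<sigma> j * ?u t j\<bar> \<le> exp (- \<Lambda> * t) * \<bar>wt \<sigma> j * z j\<bar>" if "t \<ge> 0" for t j
  proof -
    have "exp (- M j * t) \<le> exp (- \<Lambda> * t)" using that M[of j] by (simp add: mult_right_mono)
    then have "exp (- M j * t) * \<bar>wt \<sigma> j * z j\<bar> \<le> exp (- \<Lambda> * t) * \<bar>wt \<sigma> j * z j\<bar>"
      by (rule mult_right_mono) simp
    then show ?thesis by (simp add: abs_mult mult_ac)
  qed
  have u: "?u t \<in> H \<sigma>" if "t \<ge> 0" for t by (rule H_le[OF z le[OF that]])
  then show "t \<ge> 0 \<Longrightarrow> ?u t \<in> H \<sigma>" .
  show "hnorm \<sigma> (?u t) \<le> exp (- \<Lambda> * t) * hnorm \<sigma> z" if "t \<ge> 0"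
    by (rule hnorm_le[OF z le[OF that]]) simp
  show "continuous_on {0..} (\<lambda>t. emb \<sigma> (?u t))"
  proof (rule continuous_on_ell2_dominated)
    fix j
    have "continuous_on {0..} (\<lambda>t. wt \<sigma> j * (exp (- M j * t) * z j))"
      by (intro continuous_intros)
    then show "continuous_on {0..} (\<lambda>t. coord (emb \<sigma> (?u t)) j)"
      by (rule continuous_on_eq) (subst coord_emb[OF u], simp_all)
  next
    fix t :: real and j assume t: "t \<in> {0..}"
    have "exp (- \<Lambda> * t) \<le> 1" using t \<Lambda> by simp
    then have "exp (- \<Lambda> * t) * \<bar>wt \<sigma> j * z j\<bar> \<le> 1 * \<bar>wt \<sigma> j * z j\<bar>"
      by (rule mult_right_mono) simp
    then have "\<bar>wt \<sigma> j * ?u t j\<bar> \<le> \<bar>wt \<sigma> j * z j\<bar>"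
      using le[of t j] t unfolding atLeast_iff mult_1_left by (meson order_trans)
    then show "\<bar>coord (emb \<sigma> (?u t)) j\<bar> \<le> \<bar>coord (emb \<sigma> z) j\<bar>"
      unfolding coord_emb[OF u[OF t[unfolded atLeast_iff]]] coord_emb[OF z] .
  qed
qed

lemma fin_rank_has_derivative:
  assumes "\<And>p. ((\<lambda>t. u t p) has_real_derivative u' p) (at t)"
  shows "((\<lambda>t. fin_rank F c (u t) j) has_real_derivative fin_rank F c u' j) (at t)"
  unfolding fin_rank_def by (intro DERIV_add DERIV_sum DERIV_cmult assms)

section \<open>The closed loop as a conjugated diagonal system\<close>

definition finite_functional :: "int set \<Rightarrow> (int \<Rightarrow> real) \<Rightarrow> fseries \<Rightarrow> real" where
  "finite_functional F k x = (\<Sum>p\<in>F. k p * x p)"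

text \<open>A single coefficient is bounded on \<open>H s\<close> for every real \<open>s\<close>,
  so one pair of functionals can be fixed before \<open>r\<close> is chosen.\<close>

lemma bounded_finite_functional: "bounded_functional_on s (finite_functional F k)"
  unfolding bounded_functional_on_def
proof (intro conjI ballI allI)
  show "finite_functional F k (f + g) = finite_functional F k f + finite_functional F k g" for f g
    by (simp add: finite_functional_def distrib_left sum.distrib)
  show "finite_functional F k (r *\<^sub>R f) = r * finite_functional F k f" for f r
    by (simp add: finite_functional_def scaleR_fun_def sum_distrib_left mult.left_commute)
  have "\<bar>finite_functional F k f\<bar> \<le> (\<Sum>p\<in>F. \<bar>k p\<bar> / wt s p) * hnorm s f" if "f \<in> H s" for f
  proof -
    have "\<bar>finite_functional F k f\<bar> \<le> (\<Sum>p\<in>F. \<bar>k p * f p\<bar>)"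
      unfolding finite_functional_def by (rule sum_abs)
    also have "\<dots> \<le> (\<Sum>p\<in>F. \<bar>k p\<bar> * (hnorm s f / wt s p))"
      unfolding abs_mult by (intro sum_mono mult_left_mono abs_coeff_le that) simp
    finally show ?thesis by (simp add: sum_distrib_right)
  qed
  then show "\<exists>B. \<forall>f\<in>H s. \<bar>finite_functional F k f\<bar> \<le> B * hnorm s f" by blast
qed

text \<open>Interface between algebra and analysis: only the diagonal form \<open>diag\<close> and
  the decay of the columns of the two mutually inverse transformations matter from here on, not how
  they were found.\<close>

locale diagonalised_loop =
  fixes m \<Lambda> :: real and F :: "int set" and M :: "int \<Rightarrow> real" and c d :: "int \<Rightarrow> int \<Rightarrow> real"
    and k1 k2 :: "int \<Rightarrow> real" and \<phi>1 \<phi>2 :: fseries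
  assumes F: "finite F" and M: "\<forall>j. j \<notin> F \<longrightarrow> M j = (of_int j)\<^sup>2"
    and \<Lambda>: "\<Lambda> > 0" "\<And>j. M j \<ge> \<Lambda>"
    and c: "\<forall>p\<in>F. dominated (- m - 2) (\<lambda>j. c j p)" and d: "\<forall>p\<in>F. dominated (- m - 2) (\<lambda>j. d j p)"
    and cd: "\<And>x. fin_rank F c (fin_rank F d x) = x" and dc: "\<And>x. fin_rank F d (fin_rank F c x) = x"
    and \<phi>: "\<And>\<epsilon>. \<epsilon> > 0 \<Longrightarrow> \<phi>1 \<in> H (m - 1/2 - \<epsilon>)" "\<And>\<epsilon>. \<epsilon> > 0 \<Longrightarrow> \<phi>2 \<in> H (m - 1/2 - \<epsilon>)"
    and diag: "\<And>x. fin_rank F c (\<lambda>j. laplace x j +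
        (finite_functional F k1 x * \<phi>1 j + finite_functional F k2 x * \<phi>2 j)) =
      (\<lambda>j. - M j * fin_rank F c x j)"
begin

abbreviation "K1 \<equiv> finite_functional F k1"
abbreviation "K2 \<equiv> finite_functional F k2"

text \<open>The closed-loop generator. It acts coefficientwise on all formal series, so no operator
  domain has to be specified.\<close>

definition gen :: "fseries \<Rightarrow> fseries" where
  "gen x j = laplace x j + (K1 x * \<phi>1 j + K2 x * \<phi>2 j)"

definition flow :: "fseries \<Rightarrow> real \<Rightarrow> fseries" where
  "flow y0 t = fin_rank F d (\<lambda>j. exp (- M j * t) * fin_rank F c y0 j)"

lemma fin_rank_gen: "fin_rank F c (gen x) = (\<lambda>j. - M j * fin_rank F c x j)"
  using diag[of x] by (simp add: gen_def[abs_def])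

text \<open>The cancellation behind the regularity of the time derivative: the Laplacian and the
  feedback term are separately limited by the regularity of the profiles, but their sum is the
  transform of a smooth family.\<close>

lemma gen_flow: "gen (flow y0 t) = fin_rank F d (\<lambda>j. - M j * (exp (- M j * t) * fin_rank F c y0 j))"
  using dc[of "gen (flow y0 t)"] by (simp add: fin_rank_gen flow_def cd)

lemma flow_0: "flow y0 0 = y0"
  by (simp add: flow_def dc)

lemma flow_deriv: "((\<lambda>t. flow y0 t j) has_real_derivative gen (flow y0 t) j) (at t)"
  unfolding gen_flow unfolding flow_def
  by (rule fin_rank_has_derivative) (auto intro!: derivative_eq_intros)

lemma fin_rank_exponent: "s < m + 3/2 \<Longrightarrow> s + (- m - 2) < - 1/2"
  by simp

lemma M_dominated: "dominated 2 (\<lambda>j. - M j)"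
proof (rule dominated_cofinite)
  show "finite (F \<union> {0})" using F by simp
  fix j assume "j \<notin> F \<union> {0}"
  then show "\<bar>- M j\<bar> \<le> 1 * wt 2 j"
    using powr_realpow[of "\<bar>real_of_int j\<bar>" 2] by (simp add: M wt_def)
qed

lemma flow_smoothing:
  assumes y0: "y0 \<in> H \<sigma>" and \<sigma>: "\<sigma> < m + 3/2" and s: "s < m + 3/2"
  shows "t > 0 \<Longrightarrow> flow y0 t \<in> H s" "continuous_on {0<..} (\<lambda>t. emb s (flow y0 t))"
    "t > 0 \<Longrightarrow> gen (flow y0 t) \<in> H s" "continuous_on {0<..} (\<lambda>t. emb s (gen (flow y0 t)))"
proof -
  have z0: "fin_rank F c y0 \<in> H \<sigma>" by (rule fin_rank_H(1)[OF F c fin_rank_exponent[OF \<sigma>] y0])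
  have M0: "M j \<ge> 0" for j using \<Lambda>(1) \<Lambda>(2)[of j] by linarith
  have one: "dominated 0 (\<lambda>j. 1)" unfolding dominated_def by (rule exI[of _ 1]) (simp add: wt_def)
  note sm = semigroup_smoothing[where M = M, OF F M M0 z0]
  note fr = fin_rank_H(1)[OF F d fin_rank_exponent[OF s]]
  note cfr = continuous_fin_rank[OF F d fin_rank_exponent[OF s]]
  show "t > 0 \<Longrightarrow> flow y0 t \<in> H s"
    unfolding flow_def using sm(1)[OF one] by (intro fr) simp
  show "continuous_on {0<..} (\<lambda>t. emb s (flow y0 t))"
    unfolding flow_def by (rule cfr) (use sm[OF one] in simp_all)
  show "t > 0 \<Longrightarrow> gen (flow y0 t) \<in> H s"
    unfolding gen_flow by (intro fr sm(1)[OF M_dominated])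
  show "continuous_on {0<..} (\<lambda>t. emb s (gen (flow y0 t)))"
    unfolding gen_flow by (rule cfr) (use sm[OF M_dominated] in simp_all)
qed

text \<open>The diagonal part decays at the exact rate; the constant is the product of bounds for
  the two transformations on \<open>H \<sigma>\<close>, and so depends on \<open>\<sigma>\<close>
  but not on the initial value.\<close>

lemma flow_bound:
  assumes \<sigma>: "\<sigma> < m + 3/2"
  shows "\<exists>C. \<forall>y0\<in>H \<sigma>. \<forall>t\<ge>0. hnorm \<sigma> (flow y0 t) \<le> C * exp (- \<Lambda> * t) * hnorm \<sigma> y0"
proof -
  obtain B where B: "B \<ge> 0" "\<And>x. x \<in> H \<sigma> \<Longrightarrow> hnorm \<sigma> (fin_rank F c x) \<le> B * hnorm \<sigma> x"
    using fin_rank_bounded[OF F c fin_rank_exponent[OF \<sigma>]] by blast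
  obtain D where D: "D \<ge> 0" "\<And>x. x \<in> H \<sigma> \<Longrightarrow> hnorm \<sigma> (fin_rank F d x) \<le> D * hnorm \<sigma> x"
    using fin_rank_bounded[OF F d fin_rank_exponent[OF \<sigma>]] by blast
  have "hnorm \<sigma> (flow y0 t) \<le> (D * B) * exp (- \<Lambda> * t) * hnorm \<sigma> y0" if y0: "y0 \<in> H \<sigma>" and t: "t \<ge> 0" for y0 t
  proof -
    have z0: "fin_rank F c y0 \<in> H \<sigma>" by (rule fin_rank_H(1)[OF F c fin_rank_exponent[OF \<sigma>] y0])
    note sg = semigroup_decay[where M = M, OF \<Lambda>(2,1) z0]
    have "hnorm \<sigma> (flow y0 t) \<le> D * hnorm \<sigma> (\<lambda>j. exp (- M j * t) * fin_rank F c y0 j)"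
      unfolding flow_def by (rule D(2)[OF sg(1)[OF t]])
    also have "\<dots> \<le> D * (exp (- \<Lambda> * t) * hnorm \<sigma> (fin_rank F c y0))"
      by (rule mult_left_mono[OF sg(2)[OF t] D(1)])
    also have "\<dots> \<le> D * (exp (- \<Lambda> * t) * (B * hnorm \<sigma> y0))"
      by (intro mult_left_mono B(2)[OF y0] D(1)) simp
    finally show ?thesis by (simp add: mult_ac)
  qed
  then show ?thesis by blast
qed

lemma flow_continuous:
  assumes y0: "y0 \<in> H \<sigma>" and \<sigma>: "\<sigma> < m + 3/2"
  shows "flow y0 \<in> C0_H \<sigma>"
proof -
  have z0: "fin_rank F c y0 \<in> H \<sigma>" by (rule fin_rank_H(1)[OF F c fin_rank_exponent[OF \<sigma>] y0])
  note sg = semigroup_decay[where M = M, OF \<Lambda>(2,1) z0]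
  have "flow y0 t \<in> H \<sigma>" if "t \<ge> 0" for t
    unfolding flow_def by (rule fin_rank_H(1)[OF F d fin_rank_exponent[OF \<sigma>] sg(1)[OF that]])
  moreover have "continuous_on {0..} (\<lambda>t. emb \<sigma> (flow y0 t))"
    unfolding flow_def by (rule continuous_fin_rank[OF F d fin_rank_exponent[OF \<sigma>]]) (use sg in simp_all)
  ultimately show ?thesis by (simp add: C0_H_def)
qed

text \<open>The bound on \<open>s\<close> is the regularity of the profiles; for s = m + r - 1 it
  reads r < 1/2. The feedback is continuous in time because it reads finitely many
  coefficients.\<close>

lemma feedback_L2loc:
  assumes u: "\<And>t. t > 0 \<Longrightarrow> u t \<in> H \<sigma>" "continuous_on {0<..} (\<lambda>t. emb \<sigma> (u t))" and s: "s < m - 1/2"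
  shows "(\<lambda>t. K1 (u t) *\<^sub>R \<phi>1 + K2 (u t) *\<^sub>R \<phi>2) \<in> L2loc_H s"
proof (rule continuous_imp_L2loc)
  have \<phi>H: "\<phi>1 \<in> H s" "\<phi>2 \<in> H s" using \<phi>[of "m - 1/2 - s"] s by simp_all
  have eq: "a *\<^sub>R \<phi>1 + b *\<^sub>R \<phi>2 = (\<lambda>j. a * \<phi>1 j + b * \<phi>2 j)" for a b
    by (simp add: fun_eq_iff scaleR_fun_def)
  show "K1 (u t) *\<^sub>R \<phi>1 + K2 (u t) *\<^sub>R \<phi>2 \<in> H s" for t
    unfolding eq by (intro H_add H_scale \<phi>H)
  have "emb s (a *\<^sub>R \<phi>1 + b *\<^sub>R \<phi>2) = a *\<^sub>R emb s \<phi>1 + b *\<^sub>R emb s \<phi>2" for a b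
    unfolding eq by (simp add: emb_add emb_scale H_scale \<phi>H)
  moreover have "continuous_on {0<..} (\<lambda>t. K1 (u t) *\<^sub>R emb s \<phi>1 + K2 (u t) *\<^sub>R emb s \<phi>2)"
    unfolding finite_functional_def
    by (intro continuous_intros continuous_coeff[OF _ u(2)]) (simp_all add: u(1))
  ultimately show "continuous_on {0<..} (\<lambda>t. emb s (K1 (u t) *\<^sub>R \<phi>1 + K2 (u t) *\<^sub>R \<phi>2))" by simp
qed

lemma gen_minus_laplace: "gen x - laplace x = K1 x *\<^sub>R \<phi>1 + K2 x *\<^sub>R \<phi>2"
  by (simp add: fun_eq_iff gen_def scaleR_fun_def)

lemma flow_is_solution:
  assumes r: "- 1/2 < r" "r < 1/2" and y0: "y0 \<in> H (m + r)"
  shows "is_solution m r K1 K2 \<phi>1 \<phi>2 y0 (flow y0)"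
proof -
  have \<sigma>: "m + r < m + 3/2" and s1: "m + r + 1 < m + 3/2" and s2: "m + r - 1 < m + 3/2"
    and s3: "m + r - 1 < m - 1/2" using r by simp_all
  note sm = flow_smoothing[OF y0 \<sigma>]
  have L1: "flow y0 \<in> L2loc_H (m + r + 1)" by (rule continuous_imp_L2loc[OF sm(1,2)[OF s1]])
  have L2: "flow y0 \<in> L2loc_H (m + r - 1)" by (rule continuous_imp_L2loc[OF sm(1,2)[OF s2]])
  have L3: "(\<lambda>t. gen (flow y0 t)) \<in> L2loc_H (m + r - 1)" by (rule continuous_imp_L2loc[OF sm(3,4)[OF s2]])
  have L4: "(\<lambda>t. K1 (flow y0 t) *\<^sub>R \<phi>1 + K2 (flow y0 t) *\<^sub>R \<phi>2) \<in> L2loc_H (m + r - 1)"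
    by (rule feedback_L2loc[OF sm(1,2)[OF s2] s3])
  have W: "weak_deriv (m + r - 1) (flow y0) (\<lambda>t. gen (flow y0 t))"
    unfolding weak_deriv_coord[OF L2 L3]
  proof (intro allI impI)
    fix \<phi> j assume \<phi>: "test_function \<phi>"
    let ?s = "m + r - 1"
    have "(LINT t|lebesgue_on {0<..}. deriv \<phi> t * coord (emb ?s (flow y0 t)) j) =
        (LINT t|lebesgue_on {0<..}. deriv \<phi> t * (wt ?s j * flow y0 t j))"
      by (rule Bochner_Integration.integral_cong) (simp_all add: coord_emb sm(1)[OF s2])
    also have "\<dots> = - (LINT t|lebesgue_on {0<..}. \<phi> t * (wt ?s j * gen (flow y0 t) j))"
    proof (rule weak_deriv_classical[OF \<phi>])
      show "((\<lambda>t. wt ?s j * flow y0 t j) has_real_derivative wt ?s j * gen (flow y0 t) j) (at t)" for t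
        by (intro DERIV_cmult flow_deriv)
      show "continuous_on {0<..} (\<lambda>t. wt ?s j * gen (flow y0 t) j)"
        by (intro continuous_intros continuous_coeff[OF _ sm(4)[OF s2]]) (simp add: sm(3)[OF s2])
    qed
    also have "(LINT t|lebesgue_on {0<..}. \<phi> t * (wt ?s j * gen (flow y0 t) j)) =
        (LINT t|lebesgue_on {0<..}. \<phi> t * coord (emb ?s (gen (flow y0 t))) j)"
      by (rule Bochner_Integration.integral_cong) (simp_all add: coord_emb sm(3)[OF s2])
    finally show "(LINT t|lebesgue_on {0<..}. deriv \<phi> t * coord (emb ?s (flow y0 t)) j) =
        - (LINT t|lebesgue_on {0<..}. \<phi> t * coord (emb ?s (gen (flow y0 t))) j)" .
  qed
  have "closed_loop_eq (m + r - 1) K1 K2 \<phi>1 \<phi>2 (flow y0)"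
    unfolding closed_loop_eq_def
    by (rule bexI[OF _ L3]) (simp add: W gen_minus_laplace L4)
  then show ?thesis
    using flow_continuous[OF y0 \<sigma>] L1 L2 L3 W by (auto simp: is_solution_def flow_0 H1loc_H_def)
qed

text \<open>For a solution continuous in time, each coefficient of \<open>gen (x t)\<close> is
  continuous, as it involves finitely many coefficients of \<open>x t\<close>. By the equation it
  agrees almost everywhere with the weak derivative, which therefore is classical at positive
  times.\<close>

lemma solution_has_deriv:
  assumes sol: "is_solution m r K1 K2 \<phi>1 \<phi>2 y0 x" and "t > 0"
  shows "((\<lambda>t. x t j) has_real_derivative gen (x t) j) (at t)"
proof -
  let ?s = "m + r - 1"
  have xH: "\<And>t. t \<ge> 0 \<Longrightarrow> x t \<in> H (m + r)"
    and xc: "continuous_on {0..} (\<lambda>t. emb (m + r) (x t))"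
    and xL: "x \<in> L2loc_H ?s"
    using sol by (auto simp: is_solution_def C0_H_def H1loc_H_def)
  have xs: "x t \<in> H ?s" if "t \<ge> 0" for t by (rule H_mono[OF xH[OF that]]) simp
  have xj: "continuous_on {0<..} (\<lambda>t. x t j)" for j
    by (rule continuous_on_subset[OF continuous_coeff[OF _ xc]]) (auto simp: xH)
  obtain v where v: "v \<in> L2loc_H ?s" "weak_deriv ?s x v"
    and eq: "AE t in lebesgue_on {0<..}. v t - laplace (x t) = K1 (x t) *\<^sub>R \<phi>1 + K2 (x t) *\<^sub>R \<phi>2"
    using sol unfolding is_solution_def closed_loop_eq_def by blast
  have vH: "AE t in lebesgue_on {0<..}. v t \<in> H ?s"
    and vm: "(\<lambda>t. emb ?s (v t)) \<in> borel_measurable (lebesgue_on {0<..})"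
    using v(1) by (auto simp: L2loc_H_def)
  have gc: "continuous_on {0<..} (\<lambda>t. gen (x t) j)"
    unfolding gen_def laplace_def finite_functional_def by (intro continuous_intros xj)
  have "((\<lambda>t. wt ?s j * x t j) has_real_derivative wt ?s j * gen (x t) j) (at t)"
  proof (rule weak_deriv_imp_classical[OF _ _ _ \<open>t > 0\<close>])
    show "continuous_on {0<..} (\<lambda>t. wt ?s j * x t j)" "continuous_on {0<..} (\<lambda>t. wt ?s j * gen (x t) j)"
      by (intro continuous_intros xj gc)+
    fix \<phi> assume \<phi>: "test_function \<phi>"
    have "(LINT t|lebesgue_on {0<..}. deriv \<phi> t * (wt ?s j * x t j)) =
        (LINT t|lebesgue_on {0<..}. deriv \<phi> t * coord (emb ?s (x t)) j)"
      by (rule Bochner_Integration.integral_cong) (simp_all add: coord_emb xs)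
    also have "\<dots> = - (LINT t|lebesgue_on {0<..}. \<phi> t * coord (emb ?s (v t)) j)"
      using v \<phi> by (simp add: weak_deriv_coord[OF xL v(1)])
    also have "(LINT t|lebesgue_on {0<..}. \<phi> t * coord (emb ?s (v t)) j) =
        (LINT t|lebesgue_on {0<..}. \<phi> t * (wt ?s j * gen (x t) j))"
    proof (rule integral_cong_AE)
      have \<phi>m: "\<phi> \<in> borel_measurable (lebesgue_on {0<..})"
        by (rule continuous_imp_measurable_on_sets_lebesgue[OF test_function_continuous[OF \<phi>]]) simp
      have "(\<lambda>x. coord x j) \<in> borel_measurable borel"
        by (intro borel_measurable_continuous_onI bounded_linear.continuous_on[OF bounded_linear_coord] continuous_on_id)
      then show "(\<lambda>t. \<phi> t * coord (emb ?s (v t)) j) \<in> borel_measurable (lebesgue_on {0<..})"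
        by (intro borel_measurable_times \<phi>m measurable_compose[OF vm])
      show "(\<lambda>t. \<phi> t * (wt ?s j * gen (x t) j)) \<in> borel_measurable (lebesgue_on {0<..})"
        by (intro borel_measurable_times \<phi>m borel_measurable_const
            continuous_imp_measurable_on_sets_lebesgue[OF gc]) simp
      show "AE t in lebesgue_on {0<..}. \<phi> t * coord (emb ?s (v t)) j = \<phi> t * (wt ?s j * gen (x t) j)"
        using vH eq
      proof eventually_elim
        case (elim t)
        then have "v t = gen (x t)" using gen_minus_laplace[of "x t"] by (metis diff_add_cancel)
        then show ?case using elim(1) by (simp add: coord_emb)
      qed
    qed
    finally show "(LINT t|lebesgue_on {0<..}. deriv \<phi> t * (wt ?s j * x t j)) =
      - (LINT t|lebesgue_on {0<..}. \<phi> t * (wt ?s j * gen (x t) j))" .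
  qed
  from DERIV_cmult[OF this, of "1 / wt ?s j"] show ?thesis by simp
qed

lemma solution_unique:
  assumes sol: "is_solution m r K1 K2 \<phi>1 \<phi>2 y0 x" and "t \<ge> 0"
  shows "x t = flow y0 t"
proof -
  have xH: "\<And>t. t \<ge> 0 \<Longrightarrow> x t \<in> H (m + r)"
    and xc: "continuous_on {0..} (\<lambda>t. emb (m + r) (x t))" and x0: "x 0 = y0"
    using sol by (auto simp: is_solution_def C0_H_def)
  have xj: "continuous_on {0..} (\<lambda>t. x t j)" for j
    by (rule continuous_coeff[OF _ xc]) (simp add: xH)
  have z: "fin_rank F c (x t) j = exp (- M j * t) * fin_rank F c y0 j" for j
  proof (cases "t = 0")
    case False
    then have "0 < t" using \<open>t \<ge> 0\<close> by simp
    \<comment> \<open>Integrating factor. Derivatives exist at positive times only, so the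
      comparison with time 0 rests on continuity of the coefficients up to the endpoint.\<close>
    have "exp (M j * t) * fin_rank F c (x t) j = exp (M j * 0) * fin_rank F c (x 0) j"
    proof (rule DERIV_isconst_end[OF \<open>0 < t\<close>])
      have "continuous_on {0..} (\<lambda>t. fin_rank F c (x t) j)"
        unfolding fin_rank_def by (intro continuous_intros xj)
      then have "continuous_on {0..t} (\<lambda>t. fin_rank F c (x t) j)"
        by (rule continuous_on_subset) auto
      then show "continuous_on {0..t} (\<lambda>t. exp (M j * t) * fin_rank F c (x t) j)"
        by (intro continuous_intros)
      fix \<tau> assume "0 < \<tau>" "\<tau> < t"
      have "((\<lambda>t. fin_rank F c (x t) j) has_real_derivative - M j * fin_rank F c (x \<tau>) j) (at \<tau>)"
        using fin_rank_has_derivative[where u = x, OF solution_has_deriv[OF sol \<open>0 < \<tau>\<close>], where F = F and c = c and j = j]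
        by (simp add: fin_rank_gen)
      then show "((\<lambda>t. exp (M j * t) * fin_rank F c (x t) j) has_real_derivative 0) (at \<tau>)"
        by (auto intro!: derivative_eq_intros)
    qed
    then show ?thesis by (simp add: x0 exp_minus field_simps)
  qed (simp add: x0)
  have "x t = fin_rank F d (fin_rank F c (x t))" by (simp add: dc)
  also have "fin_rank F c (x t) = (\<lambda>j. exp (- M j * t) * fin_rank F c y0 j)" by (rule ext) (rule z)
  finally show ?thesis by (simp add: flow_def)
qed

end

section \<open>Choice of the rates and assembly\<close>

theorem theorem1p1:
  fixes m c C :: real and a1 a2 :: "nat \<Rightarrow> real" and \<phi>1 \<phi>2 :: fseries
  assumes "m \<ge> 0"
    and "\<phi>1 = sin_series a1" and "\<phi>2 = cos_series a2"
    and "\<forall>\<epsilon>>0. \<phi>1 \<in> H (m - 1/2 - \<epsilon>)" and "\<forall>\<epsilon>>0. \<phi>2 \<in> H (m - 1/2 - \<epsilon>)"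
    and "a2 0 \<noteq> 0"
    and "c > 0" and "C > 0"
    and "\<forall>n\<ge>1. c * real n powr (- m) < \<bar>a1 n\<bar> \<and> \<bar>a1 n\<bar> < C * real n powr (- m)"
    and "\<forall>n\<ge>1. c * real n powr (- m) < \<bar>a2 n\<bar> \<and> \<bar>a2 n\<bar> < C * real n powr (- m)"
  shows "\<forall>\<Lambda>>0. \<exists>K1 K2.
    (\<forall>\<epsilon>>0. bounded_functional_on (m + 1/2 + \<epsilon>) K1 \<and> bounded_functional_on (m + 1/2 + \<epsilon>) K2) \<and>
    (\<forall>r. -1/2 < r \<and> r < 1/2 \<longrightarrow>
      (\<exists>C\<^sub>r. \<forall>y0 \<in> H (m + r). \<exists>y.
        is_solution m r K1 K2 \<phi>1 \<phi>2 y0 y \<and>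
        (\<forall>z. is_solution m r K1 K2 \<phi>1 \<phi>2 y0 z \<longrightarrow> (\<forall>t\<ge>0. z t = y t)) \<and>
        (\<forall>t\<ge>0. hnorm (m + r) (y t) \<le> C\<^sub>r * exp (- \<Lambda> * t) * hnorm (m + r) y0)))"
proof (intro allI impI)
  fix \<Lambda> :: real assume \<Lambda>: "\<Lambda> > 0"
  \<comment> \<open>The profiles live on disjoint sets of indices, so one sequence carries both, and
    the sign of the index recovers the control.\<close>
  define \<beta> where "\<beta> j = \<phi>1 j + \<phi>2 j" for j
  have \<phi>: "\<phi>1 j = (if j < 0 then \<beta> j else 0)" "\<phi>2 j = (if j < 0 then 0 else \<beta> j)" for j
    by (simp_all add: \<beta>_def assms(2,3) sin_series_def cos_series_def)
  have a: "0 < \<bar>a1 n\<bar>" "0 < \<bar>a2 n\<bar>" if "n \<ge> 1" for n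
  proof -
    have "0 < c * real n powr (- m)" using \<open>c > 0\<close> that by simp
    then show "0 < \<bar>a1 n\<bar>" "0 < \<bar>a2 n\<bar>" using assms(9,10) that by force+
  qed
  have \<beta>0: "\<beta> j \<noteq> 0" for j
    using a[of "nat (- j)"] a[of "nat j"] \<open>a2 0 \<noteq> 0\<close>
    by (auto simp: \<beta>_def assms(2,3) sin_series_def cos_series_def)
  have \<beta>d: "dominated (- m) \<beta>"
  proof (rule dominated_cofinite)
    show "finite {0 :: int}" by simp
    fix j :: int assume "j \<notin> {0}"
    then have "j \<noteq> 0" by simp
    define n where "n = nat \<bar>j\<bar>"
    have n: "n \<ge> 1" "real n = \<bar>real_of_int j\<bar>" using \<open>j \<noteq> 0\<close> by (simp_all add: n_def)
    have "\<bar>a1 n\<bar> \<le> C * wt (- m) j" "\<bar>a2 n\<bar> \<le> C * wt (- m) j"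
      using assms(9,10) n \<open>j \<noteq> 0\<close> by (force simp: wt_def)+
    moreover have "\<bar>\<beta> j\<bar> = sqrt pi * \<bar>a1 n\<bar> \<or> \<bar>\<beta> j\<bar> = sqrt pi * \<bar>a2 n\<bar>"
      using \<open>j \<noteq> 0\<close> by (auto simp: \<beta>_def assms(2,3) sin_series_def cos_series_def n_def abs_mult)
    ultimately show "\<bar>\<beta> j\<bar> \<le> (sqrt pi * C) * wt (- m) j"
      by (auto simp: mult.assoc intro: mult_left_mono)
  qed
  \<comment> \<open>A window of radius \<open>N\<close> rather than its square root avoids roots:
    integers satisfy |j| <= j^2, so the modes outside the window are fast enough.\<close>
  define N :: int where "N = \<lceil>\<Lambda>\<rceil>"
  have N: "\<Lambda> \<le> of_int N" by (simp add: N_def)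
  define F where "F = {- N..N}"
  \<comment> \<open>The summand 1/2 excludes squares (doubled, an odd number would equal an even
    one), \<open>N\<close> secures the rate, and |p| separates the indices within a sign
    class.\<close>
  define \<nu> where "\<nu> p = of_int (N + \<bar>p\<bar>) + (1 / 2 :: real)" for p
  define M where "M j = (if j \<in> F then \<nu> j else (of_int j)\<^sup>2)" for j
  have F: "finite F" by (simp add: F_def)
  have \<nu>sq: "\<nu> p \<noteq> (of_int j)\<^sup>2" for p j
  proof
    assume "\<nu> p = (of_int j)\<^sup>2"
    then have "real_of_int (2 * (N + \<bar>p\<bar>) + 1) = real_of_int (2 * j\<^sup>2)" by (simp add: \<nu>_def)
    then have "2 * (N + \<bar>p\<bar>) + 1 = 2 * j\<^sup>2" by (simp only: of_int_eq_iff)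
    then show False by presburger
  qed
  have \<nu>inj: "\<nu> p \<noteq> \<nu> q" if "p \<noteq> q" "(p < 0) = (q < 0)" for p q
  proof
    assume "\<nu> p = \<nu> q"
    then have "\<bar>p\<bar> = \<bar>q\<bar>" by (simp add: \<nu>_def)
    then show False using that by linarith
  qed
  obtain k b d \<beta>' where b: "\<forall>p\<in>F. dominated (- m - 2) (\<lambda>j. b j p)" and d: "\<forall>p\<in>F. dominated (- m - 2) (\<lambda>j. d j p)"
    and bd: "\<And>x. fin_rank F b (fin_rank F d x) = x" and db: "\<And>x. fin_rank F d (fin_rank F b x) = x"
    and E: "\<And>x u. fin_rank F b (\<lambda>j. - (of_int j)\<^sup>2 * x j + \<beta> j * ((\<Sum>p\<in>F. k (j < 0) p * x p) + u (j < 0))) =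
      (\<lambda>j. - M j * fin_rank F b x j + \<beta>' j * u (j < 0))"
    using pole_shift[where \<nu> = \<nu>, OF F \<beta>0 \<beta>d \<nu>sq \<nu>inj order_refl] unfolding M_def by blast
  \<comment> \<open>All poles in the window have been moved, so the free input is set to zero.
    \<open>True\<close> marks negative indices, hence \<open>k True\<close> belongs to the sine
    profile.\<close>
  interpret diagonalised_loop m \<Lambda> F M b d "k True" "k False" \<phi>1 \<phi>2
  proof
    show "\<forall>j. j \<notin> F \<longrightarrow> M j = (of_int j)\<^sup>2" by (simp add: M_def)
    show "M j \<ge> \<Lambda>" for j
    proof (cases "j \<in> F")
      case True
      then show ?thesis using N by (simp add: M_def \<nu>_def)
    next
      case False
      then have "N \<le> \<bar>j\<bar>" by (auto simp: F_def)
      also have "\<bar>j\<bar> \<le> j\<^sup>2" using self_le_power[of "\<bar>j\<bar>" 2] by (cases "j = 0") auto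
      finally have "real_of_int N \<le> real_of_int (j\<^sup>2)" by (simp only: of_int_le_iff)
      then have "\<Lambda> \<le> (real_of_int j)\<^sup>2" using N unfolding of_int_power by linarith
      then show ?thesis using False by (simp add: M_def)
    qed
    show "fin_rank F b (\<lambda>j. laplace x j +
        (finite_functional F (k True) x * \<phi>1 j + finite_functional F (k False) x * \<phi>2 j)) =
      (\<lambda>j. - M j * fin_rank F b x j)" for x
    proof -
      have "(\<lambda>j. laplace x j + (finite_functional F (k True) x * \<phi>1 j + finite_functional F (k False) x * \<phi>2 j)) =
          (\<lambda>j. - (of_int j)\<^sup>2 * x j + \<beta> j * ((\<Sum>p\<in>F. k (j < 0) p * x p) + 0))"
      proof
        fix j show "laplace x j + (finite_functional F (k True) x * \<phi>1 j + finite_functional F (k False) x * \<phi>2 j) =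
            - (of_int j)\<^sup>2 * x j + \<beta> j * ((\<Sum>p\<in>F. k (j < 0) p * x p) + 0)"
          by (cases "j < 0") (simp_all add: laplace_def finite_functional_def \<phi> mult.commute)
      qed
      then show ?thesis using E[of x "\<lambda>_. 0"] by simp
    qed
  qed (use F \<Lambda> b d bd db assms(4,5) in auto)
  show "\<exists>K1 K2.
    (\<forall>\<epsilon>>0. bounded_functional_on (m + 1/2 + \<epsilon>) K1 \<and> bounded_functional_on (m + 1/2 + \<epsilon>) K2) \<and>
    (\<forall>r. -1/2 < r \<and> r < 1/2 \<longrightarrow>
      (\<exists>C\<^sub>r. \<forall>y0 \<in> H (m + r). \<exists>y.
        is_solution m r K1 K2 \<phi>1 \<phi>2 y0 y \<and>
        (\<forall>z. is_solution m r K1 K2 \<phi>1 \<phi>2 y0 z \<longrightarrow> (\<forall>t\<ge>0. z t = y t)) \<and>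
        (\<forall>t\<ge>0. hnorm (m + r) (y t) \<le> C\<^sub>r * exp (- \<Lambda> * t) * hnorm (m + r) y0)))"
  proof (rule exI[of _ K1], rule exI[of _ K2], intro conjI allI impI bounded_finite_functional)
    fix r :: real assume r: "-1/2 < r \<and> r < 1/2"
    then have "m + r < m + 3/2" by simp
    then obtain D where D: "\<forall>y0\<in>H (m + r). \<forall>t\<ge>0. hnorm (m + r) (flow y0 t) \<le> D * exp (- \<Lambda> * t) * hnorm (m + r) y0"
      using flow_bound by blast
    show "\<exists>C\<^sub>r. \<forall>y0 \<in> H (m + r). \<exists>y.
        is_solution m r K1 K2 \<phi>1 \<phi>2 y0 y \<and>
        (\<forall>z. is_solution m r K1 K2 \<phi>1 \<phi>2 y0 z \<longrightarrow> (\<forall>t\<ge>0. z t = y t)) \<and>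
        (\<forall>t\<ge>0. hnorm (m + r) (y t) \<le> C\<^sub>r * exp (- \<Lambda> * t) * hnorm (m + r) y0)"
    proof (rule exI[of _ D], intro ballI)
      fix y0 assume y0: "y0 \<in> H (m + r)"
      show "\<exists>y. is_solution m r K1 K2 \<phi>1 \<phi>2 y0 y \<and>
        (\<forall>z. is_solution m r K1 K2 \<phi>1 \<phi>2 y0 z \<longrightarrow> (\<forall>t\<ge>0. z t = y t)) \<and>
        (\<forall>t\<ge>0. hnorm (m + r) (y t) \<le> D * exp (- \<Lambda> * t) * hnorm (m + r) y0)"
      proof (intro exI[of _ "flow y0"] conjI allI impI)
        show "is_solution m r K1 K2 \<phi>1 \<phi>2 y0 (flow y0)"
          by (rule flow_is_solution[OF _ _ y0]) (use r in simp_all)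
        show "z t = flow y0 t" if "is_solution m r K1 K2 \<phi>1 \<phi>2 y0 z" "t \<ge> 0" for z t
          by (rule solution_unique[OF that])
        show "hnorm (m + r) (flow y0 t) \<le> D * exp (- \<Lambda> * t) * hnorm (m + r) y0" if "t \<ge> 0" for t
          using D y0 that by blast
      qed
    qed
  qed
qed

end
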